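(* Let $\mathcal{M}$ be a smooth connected Riemannian manifold of dimension $n+m$ equipped with a foliation with $m$-dimensional leaves, let $\mathcal{L}=\Delta_{\mathcal{V}}+Y$ be a Kolmogorov type operator on $\mathcal{M}$, and let $\nabla$ be the Hladky connection of the foliation, with torsion $T$ and Ricci curvature $\mathbf{Ric}$. Then for every $f\in C_0^\infty(\mathcal{M})$, $$\Gamma_2(f)=\|\nabla^2_{\mathcal{V}}f\|^2+\mathbf{Ric}(\nabla_{\mathcal{V}}f,\nabla_{\mathcal{V}}f)-\nabla Y(\nabla_{\mathcal{V}}f,\nabla f)-\langle T(Y,\nabla_{\mathcal{V}}f),\nabla f\rangle,$$ where $\|\nabla^2_{\mathcal{V}}f\|^2$ is the squared Hilbert-Schmidt norm of the vertical Hessian.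
   Context: The foliation is not assumed to be bundle-like or totally geodesic. $\mathcal{V}$ (vertical bundle) is the tangent bundle of the leaves and $\mathcal{H}$ (horizontal bundle) its orthogonal complement; subscripts $\mathcal{V},\mathcal{H}$ denote orthogonal projections. $\nabla f=\nabla_{\mathcal{H}}f+\nabla_{\mathcal{V}}f$ is the Riemannian gradient of $f$ with its horizontal and vertical parts. $\Delta_{\mathcal{V}}$ is the vertical Laplacian (the Laplace-Beltrami operator along the leaves). A Kolmogorov type operator is a hypoelliptic diffusion operator of the form $\mathcal{L}=\Delta_{\mathcal{V}}+Y$ with $Y$ a smooth vector field on $\mathcal{M}$. $C_0^\infty(\mathcal{M})$ denotes smooth compactly supported functions. Adapted frames: a local orthonormal frame $X_1,\dots,X_n,Z_1,\dots,Z_m$ with $X_i$ horizontal and $Z_\alpha$ vertical, with structure constants $[Z_\gamma,Z_\beta]=\sum_\alpha\omega_{\gamma\beta}^\alpha Z_\alpha$ and $[Z_\beta,X_i]=\sum_k\omega_{\beta i}^kX_k+\sum_\alpha\omega_{\beta i}^\alpha Z_\alpha$. In such a frame $\Delta_{\mathcal{V}}=\sum_\alpha Z_\alpha^2-\sum_{\alpha,\beta}\omega_{\alpha\beta}^\beta Z_\alpha$. Hladky connection: the metric connection $\nabla$ for which $\mathcal{H}$ and $\mathcal{V}$ are parallel, $\nabla_UV=(D_UV)_{\mathcal{H}}$ for $U,V$ horizontal and $\nabla_UV=(D_UV)_{\mathcal{V}}$ for $U,V$ vertical ($D$ the Levi-Civita connection), and, in adapted frames, $$\nabla_{Z_\beta}X_j=\tfrac12\sum_k(\omega_{\beta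 j}^k-\omega_{\beta k}^j)X_k,\qquad \nabla_{X_i}Z_\beta=-\tfrac12\sum_\alpha(\omega_{\beta i}^\alpha-\omega_{\alpha i}^\beta)Z_\alpha .$$ Its torsion $T(U,V)=\nabla_UV-\nabla_VU-[U,V]$ satisfies $T(U,V)=0$ for $U,V$ vertical, $T(U,V)=-[U,V]_{\mathcal{V}}$ for $U,V$ horizontal, and $T(Z_\beta,X_j)=-\tfrac12\sum_k(\omega_{\beta k}^j+\omega_{\beta j}^k)X_k-\tfrac12\sum_\alpha(\omega_{\alpha j}^\beta+\omega_{\beta j}^\alpha)Z_\alpha$. Vertical Hessian: $\nabla^2_{\mathcal{V}}f(U,V)=\langle\nabla_U\nabla_{\mathcal{V}}f,V\rangle$ for $U,V$ vertical, and $0$ if $U$ or $V$ is horizontal. $\mathbf{Ric}(U,V)$ is the trace of $W\mapsto R(W,U)V$, with $R(W,U)=[\nabla_W,\nabla_U]-\nabla_{[W,U]}$ the curvature tensor of $\nabla$. $\nabla Y(U,V)=\langle\nabla_UY,V\rangle$. $\Gamma(f,g)=\langle\nabla_{\mathcal{V}}f,\nabla_{\mathcal{V}}g\rangle$, $\Gamma_2(f,g)=\frac12\left(\mathcal{L}\Gamma(f,g)-\Gamma(g,\mathcal{L}f)-\Gamma(f,\mathcal{L}g)\right)$, and $\Gamma_2(f)=\Gamma_2(f,f)$. *)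

theory Defs
  imports "HOL-Analysis.Analysis"
begin

section \<open>Smooth maps between Euclidean spaces\<close>

primrec times_differentiable ::
    "nat \<Rightarrow> 'e::euclidean_space set \<Rightarrow> ('e \<Rightarrow> 'b::real_normed_vector) \<Rightarrow> bool" where
  "times_differentiable 0 S f = continuous_on S f"
| "times_differentiable (Suc k) S f =
     ((\<forall>x\<in>S. f differentiable at x) \<and>
      (\<forall>v. times_differentiable k S (\<lambda>x. frechet_derivative f (at x) v)))"

text \<open>Only used for open \<open>S\<close>; the values of \<open>f\<close> outside \<open>S\<close> are then irrelevant.\<close>

definition smooth_on :: "'e::euclidean_space set \<Rightarrow> ('e \<Rightarrow> 'b::real_normed_vector) \<Rightarrow> bool" where
  "smooth_on S f \<longleftrightarrow> (\<forall>k. times_differentiable k S f)"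


section \<open>Foliated Riemannian manifolds\<close>

text \<open>
  A chart is a pair of an open domain and a map into the model space \<open>'e\<close>.  All charts of the
  atlas are foliated charts: the set \<open>leafdirs\<close> of coordinate directions is tangent to the plaques
  and the remaining coordinate directions are transverse to them.

  The tangent space at \<open>p\<close> is the model space \<open>'e\<close>, a tangent vector at \<open>p\<close> being represented by its
  components in the chart \<open>chart_at M p\<close>, which is chosen once and for all.  A vector field is thus a
  function \<open>'a \<Rightarrow> 'e\<close>, and \<open>gmetric M p\<close> is a bilinear form on \<open>'e\<close>.
\<close>

type_synonym ('a, 'e) chart = "'a set \<times> ('a \<Rightarrow> 'e)"

record ('a, 'e) foliated =
  atlas :: "('a, 'e) chart set"
  leafdirs :: "'e set"
  gmetric :: "'a \<Rightarrow> 'e \<Rightarrow> 'e \<Rightarrow> real"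

abbreviation cdom :: "('a, 'e) chart \<Rightarrow> 'a set" where "cdom \<equiv> fst"
abbreviation cmap :: "('a, 'e) chart \<Rightarrow> 'a \<Rightarrow> 'e" where "cmap \<equiv> snd"

definition cinv :: "('a, 'e) chart \<Rightarrow> 'e \<Rightarrow> 'a" where
  "cinv c = inv_into (cdom c) (cmap c)"

definition is_chart :: "('a::topological_space, 'e::euclidean_space) chart \<Rightarrow> bool" where
  "is_chart c \<longleftrightarrow> open (cdom c) \<and> open (cmap c ` cdom c) \<and>
     homeomorphism (cdom c) (cmap c ` cdom c) (cmap c) (cinv c)"

definition smooth_transition :: "('a, 'e::euclidean_space) chart \<Rightarrow> ('a, 'e) chart \<Rightarrow> bool" where
  "smooth_transition c c' \<longleftrightarrow> smooth_on (cmap c ` (cdom c \<inter> cdom c')) (cmap c' \<circ> cinv c)"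

text \<open>
  Locally the transition map is of the form \<open>(x, y) \<mapsto> (h x, k x y)\<close>, where \<open>x\<close> stands for the
  transverse coordinates and \<open>y\<close> for those along \<open>B\<close>.
\<close>

definition foliated_transition ::
    "'e set \<Rightarrow> ('a, 'e::euclidean_space) chart \<Rightarrow> ('a, 'e) chart \<Rightarrow> bool" where
  "foliated_transition B c c' \<longleftrightarrow>
     (\<forall>x \<in> cmap c ` (cdom c \<inter> cdom c').
        \<exists>W. open W \<and> x \<in> W \<and> W \<subseteq> cmap c ` (cdom c \<inter> cdom c') \<and>
          (\<forall>y\<in>W. \<forall>z\<in>W. (\<forall>b \<in> Basis - B. y \<bullet> b = z \<bullet> b) \<longrightarrow>
             (\<forall>b \<in> Basis - B. cmap c' (cinv c y) \<bullet> b = cmap c' (cinv c z) \<bullet> b)))"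

definition chart_at :: "('a, 'e) foliated \<Rightarrow> 'a \<Rightarrow> ('a, 'e) chart" where
  "chart_at M p = (SOME c. c \<in> atlas M \<and> p \<in> cdom c)"

text \<open>\<open>to_coord M c p\<close> is the differential at \<open>p\<close> of the chart \<open>c\<close>, from the tangent space at \<open>p\<close>
  to \<open>'e\<close>, and \<open>of_coord M c p\<close> is its inverse.\<close>

definition to_coord ::
    "('a, 'e::euclidean_space) foliated \<Rightarrow> ('a, 'e) chart \<Rightarrow> 'a \<Rightarrow> 'e \<Rightarrow> 'e" where
  "to_coord M c p v =
     frechet_derivative (cmap c \<circ> cinv (chart_at M p)) (at (cmap (chart_at M p) p)) v"

definition of_coord ::
    "('a, 'e::euclidean_space) foliated \<Rightarrow> ('a, 'e) chart \<Rightarrow> 'a \<Rightarrow> 'e \<Rightarrow> 'e" where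
  "of_coord M c p v =
     frechet_derivative (cmap (chart_at M p) \<circ> cinv c) (at (cmap c p)) v"

definition foliated_riemannian_manifold ::
    "nat \<Rightarrow> nat \<Rightarrow>
     ('a::{t2_space, second_countable_topology}, 'e::euclidean_space) foliated \<Rightarrow> bool" where
  "foliated_riemannian_manifold n m M \<longleftrightarrow>
     DIM('e) = n + m \<and> leafdirs M \<subseteq> Basis \<and> card (leafdirs M) = m \<and>
     (\<forall>c \<in> atlas M. is_chart c) \<and> (\<Union>c \<in> atlas M. cdom c) = UNIV \<and>
     (\<forall>c \<in> atlas M. \<forall>c' \<in> atlas M.
        smooth_transition c c' \<and> foliated_transition (leafdirs M) c c') \<and>
     (\<forall>p. bilinear (gmetric M p) \<and> (\<forall>v w. gmetric M p v w = gmetric M p w v) \<and>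
        (\<forall>v. v \<noteq> 0 \<longrightarrow> gmetric M p v v > 0)) \<and>
     (\<forall>c \<in> atlas M. \<forall>v w. smooth_on (cmap c ` cdom c)
        (\<lambda>y. gmetric M (cinv c y) (of_coord M c (cinv c y) v) (of_coord M c (cinv c y) w)))"


section \<open>Smooth functions and vector fields\<close>

definition smooth_fun_on ::
    "('a, 'e::euclidean_space) foliated \<Rightarrow> 'a set \<Rightarrow> ('a \<Rightarrow> real) \<Rightarrow> bool" where
  "smooth_fun_on M U f \<longleftrightarrow> (\<forall>c \<in> atlas M. smooth_on (cmap c ` (U \<inter> cdom c)) (f \<circ> cinv c))"

definition smooth_compactly_supported ::
    "('a::topological_space, 'e::euclidean_space) foliated \<Rightarrow> ('a \<Rightarrow> real) set" where
  "smooth_compactly_supported M =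
     {f. smooth_fun_on M UNIV f \<and> compact (closure {p. f p \<noteq> 0})}"

definition field_rep ::
    "('a, 'e::euclidean_space) foliated \<Rightarrow> ('a, 'e) chart \<Rightarrow> ('a \<Rightarrow> 'e) \<Rightarrow> 'e \<Rightarrow> 'e" where
  "field_rep M c X y = to_coord M c (cinv c y) (X (cinv c y))"

definition smooth_field_on ::
    "('a, 'e::euclidean_space) foliated \<Rightarrow> 'a set \<Rightarrow> ('a \<Rightarrow> 'e) \<Rightarrow> bool" where
  "smooth_field_on M U X \<longleftrightarrow>
     (\<forall>c \<in> atlas M. smooth_on (cmap c ` (U \<inter> cdom c)) (field_rep M c X))"

definition dir_deriv ::
    "('a, 'e::euclidean_space) foliated \<Rightarrow> ('a \<Rightarrow> real) \<Rightarrow> 'a \<Rightarrow> 'e \<Rightarrow> real" where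
  "dir_deriv M f p v =
     frechet_derivative (f \<circ> cinv (chart_at M p)) (at (cmap (chart_at M p) p)) v"

definition field_app ::
    "('a, 'e::euclidean_space) foliated \<Rightarrow> ('a \<Rightarrow> 'e) \<Rightarrow> ('a \<Rightarrow> real) \<Rightarrow> 'a \<Rightarrow> real" where
  "field_app M X f p = dir_deriv M f p (X p)"

definition lie_bracket ::
    "('a, 'e::euclidean_space) foliated \<Rightarrow> ('a \<Rightarrow> 'e) \<Rightarrow> ('a \<Rightarrow> 'e) \<Rightarrow> 'a \<Rightarrow> 'e" where
  "lie_bracket M X Y p =
     (let c = chart_at M p; x = cmap c p in
        frechet_derivative (field_rep M c Y) (at x) (field_rep M c X x) -
        frechet_derivative (field_rep M c X) (at x) (field_rep M c Y x))"

text \<open>The field with constant components \<open>v\<close> in the chart at \<open>p\<close>, defined near \<open>p\<close>; its value at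
  \<open>p\<close> is \<open>v\<close>.\<close>

definition const_field :: "('a, 'e::euclidean_space) foliated \<Rightarrow> 'a \<Rightarrow> 'e \<Rightarrow> 'a \<Rightarrow> 'e" where
  "const_field M p v q = of_coord M (chart_at M p) q v"


section \<open>Vertical and horizontal bundles, gradients\<close>

definition vertical :: "('a, 'e::euclidean_space) foliated \<Rightarrow> 'a \<Rightarrow> 'e set" where
  "vertical M p =
     {v. \<forall>c \<in> atlas M. p \<in> cdom c \<longrightarrow> to_coord M c p v \<in> span (leafdirs M)}"

definition horizontal :: "('a, 'e::euclidean_space) foliated \<Rightarrow> 'a \<Rightarrow> 'e set" where
  "horizontal M p = {v. \<forall>w \<in> vertical M p. gmetric M p v w = 0}"

definition vproj :: "('a, 'e::euclidean_space) foliated \<Rightarrow> 'a \<Rightarrow> 'e \<Rightarrow> 'e" where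
  "vproj M p v = (THE w. w \<in> vertical M p \<and> v - w \<in> horizontal M p)"

definition hproj :: "('a, 'e::euclidean_space) foliated \<Rightarrow> 'a \<Rightarrow> 'e \<Rightarrow> 'e" where
  "hproj M p v = (THE w. w \<in> horizontal M p \<and> v - w \<in> vertical M p)"

definition vertical_on :: "('a, 'e::euclidean_space) foliated \<Rightarrow> 'a set \<Rightarrow> ('a \<Rightarrow> 'e) \<Rightarrow> bool" where
  "vertical_on M U X \<longleftrightarrow> (\<forall>p\<in>U. X p \<in> vertical M p)"

definition horizontal_on :: "('a, 'e::euclidean_space) foliated \<Rightarrow> 'a set \<Rightarrow> ('a \<Rightarrow> 'e) \<Rightarrow> bool" where
  "horizontal_on M U X \<longleftrightarrow> (\<forall>p\<in>U. X p \<in> horizontal M p)"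

definition grad :: "('a, 'e::euclidean_space) foliated \<Rightarrow> ('a \<Rightarrow> real) \<Rightarrow> 'a \<Rightarrow> 'e" where
  "grad M f p = (THE v. \<forall>w. gmetric M p v w = dir_deriv M f p w)"

definition vgrad :: "('a, 'e::euclidean_space) foliated \<Rightarrow> ('a \<Rightarrow> real) \<Rightarrow> 'a \<Rightarrow> 'e" where
  "vgrad M f p = vproj M p (grad M f p)"


section \<open>Adapted frames and the vertical Laplacian\<close>

text \<open>
  Frames are indexed by the standard basis of \<open>'e\<close>: the fields \<open>F b\<close> with \<open>b\<close> in \<open>leafdirs M\<close> are the
  vertical fields \<open>Z\<^sub>\<alpha>\<close>, the others are the horizontal fields \<open>X\<^sub>i\<close>.
\<close>

definition adapted_frame ::
    "('a::topological_space, 'e::euclidean_space) foliated \<Rightarrow> 'a set \<Rightarrow> ('e \<Rightarrow> 'a \<Rightarrow> 'e) \<Rightarrow> bool" where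
  "adapted_frame M U F \<longleftrightarrow> open U \<and>
     (\<forall>b \<in> Basis. smooth_field_on M U (F b)) \<and>
     (\<forall>p\<in>U. \<forall>a \<in> Basis. \<forall>b \<in> Basis.
        gmetric M p (F a p) (F b p) = (if a = b then 1 else 0)) \<and>
     (\<forall>b \<in> leafdirs M. vertical_on M U (F b)) \<and>
     (\<forall>b \<in> Basis - leafdirs M. horizontal_on M U (F b))"

text \<open>\<open>struct_const M F a b c\<close> is the component of \<open>[F a, F b]\<close> along \<open>F c\<close>.\<close>

definition struct_const ::
    "('a, 'e::euclidean_space) foliated \<Rightarrow> ('e \<Rightarrow> 'a \<Rightarrow> 'e) \<Rightarrow> 'e \<Rightarrow> 'e \<Rightarrow> 'e \<Rightarrow> 'a \<Rightarrow> real" where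
  "struct_const M F a b c p = gmetric M p (lie_bracket M (F a) (F b) p) (F c p)"

definition frame_laplacian ::
    "('a, 'e::euclidean_space) foliated \<Rightarrow> ('e \<Rightarrow> 'a \<Rightarrow> 'e) \<Rightarrow> ('a \<Rightarrow> real) \<Rightarrow> 'a \<Rightarrow> real" where
  "frame_laplacian M F f p =
     (\<Sum>a \<in> leafdirs M. field_app M (F a) (field_app M (F a) f) p) -
     (\<Sum>a \<in> leafdirs M. \<Sum>b \<in> leafdirs M. struct_const M F a b b p * field_app M (F a) f p)"

text \<open>The Laplace-Beltrami operator along the leaves; the value does not depend on the adapted
  frame chosen around \<open>p\<close>.\<close>

definition vlaplacian ::
    "('a::topological_space, 'e::euclidean_space) foliated \<Rightarrow> ('a \<Rightarrow> real) \<Rightarrow> 'a \<Rightarrow> real" where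
  "vlaplacian M f p =
     frame_laplacian M (SOME F. \<exists>U. p \<in> U \<and> adapted_frame M U F) f p"


section \<open>Kolmogorov type operators\<close>

definition kolmogorov_op ::
    "('a::topological_space, 'e::euclidean_space) foliated \<Rightarrow> ('a \<Rightarrow> 'e) \<Rightarrow>
     ('a \<Rightarrow> real) \<Rightarrow> 'a \<Rightarrow> real" where
  "kolmogorov_op M Y f p = vlaplacian M f p + field_app M Y f p"

definition test_functions :: "'e::euclidean_space set \<Rightarrow> ('e \<Rightarrow> real) set" where
  "test_functions W = {\<phi>. smooth_on UNIV \<phi> \<and>
     compact (closure {x. \<phi> x \<noteq> 0}) \<and> closure {x. \<phi> x \<noteq> 0} \<subseteq> W}"

primrec iter_deriv :: "'e::euclidean_space list \<Rightarrow> ('e \<Rightarrow> real) \<Rightarrow> 'e \<Rightarrow> real" where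
  "iter_deriv [] \<phi> = \<phi>"
| "iter_deriv (b # bs) \<phi> = (\<lambda>x. frechet_derivative (iter_deriv bs \<phi>) (at x) b)"

definition is_distribution :: "'e::euclidean_space set \<Rightarrow> (('e \<Rightarrow> real) \<Rightarrow> real) \<Rightarrow> bool" where
  "is_distribution W u \<longleftrightarrow>
     (\<forall>\<phi> \<in> test_functions W. \<forall>\<psi> \<in> test_functions W. u (\<lambda>x. \<phi> x + \<psi> x) = u \<phi> + u \<psi>) \<and>
     (\<forall>\<phi> \<in> test_functions W. \<forall>r. u (\<lambda>x. r * \<phi> x) = r * u \<phi>) \<and>
     (\<forall>K. compact K \<and> K \<subseteq> W \<longrightarrow>
        (\<exists>C N. \<forall>\<phi> \<in> test_functions W. closure {x. \<phi> x \<noteq> 0} \<subseteq> K \<longrightarrow>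
           (\<forall>s. (\<forall>bs x. set bs \<subseteq> Basis \<and> length bs \<le> N \<longrightarrow> \<bar>iter_deriv bs \<phi> x\<bar> \<le> s) \<longrightarrow>
              \<bar>u \<phi>\<bar> \<le> C * s)))"

definition op_in_chart ::
    "(('a \<Rightarrow> real) \<Rightarrow> 'a \<Rightarrow> real) \<Rightarrow> ('a, 'e) chart \<Rightarrow> ('e \<Rightarrow> real) \<Rightarrow> 'e \<Rightarrow> real" where
  "op_in_chart L c \<eta> y = L (\<lambda>q. if q \<in> cdom c then \<eta> (cmap c q) else 0) (cinv c y)"

text \<open>\<open>P u = h\<close> on \<open>W\<close> in the sense of distributions, i.e. \<open>u (P\<^sup>t \<phi>) = \<integral> h \<phi>\<close> for all test
  functions \<open>\<phi>\<close>.  The condition on \<open>\<psi>\<close> says that \<open>\<psi> = P\<^sup>t \<phi>\<close>.\<close>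

definition distributional_eq ::
    "'e::euclidean_space set \<Rightarrow> (('e \<Rightarrow> real) \<Rightarrow> 'e \<Rightarrow> real) \<Rightarrow>
     (('e \<Rightarrow> real) \<Rightarrow> real) \<Rightarrow> ('e \<Rightarrow> real) \<Rightarrow> bool" where
  "distributional_eq W P u h \<longleftrightarrow>
     (\<forall>\<phi> \<in> test_functions W. \<forall>\<psi> \<in> test_functions W.
        (\<forall>\<eta> \<in> test_functions W.
           (\<integral>x. P \<eta> x * \<phi> x \<partial>lborel) = (\<integral>x. \<eta> x * \<psi> x \<partial>lborel)) \<longrightarrow>
        u \<psi> = (\<integral>x. h x * \<phi> x \<partial>lborel))"

text \<open>Hypoellipticity: a distribution \<open>u\<close> is smooth wherever \<open>L u\<close> is.  This is a local property,
  stated in charts.\<close>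

definition hypoelliptic ::
    "('a, 'e::euclidean_space) foliated \<Rightarrow> (('a \<Rightarrow> real) \<Rightarrow> 'a \<Rightarrow> real) \<Rightarrow> bool" where
  "hypoelliptic M L \<longleftrightarrow>
     (\<forall>c \<in> atlas M. \<forall>W u h.
        open W \<and> W \<subseteq> cmap c ` cdom c \<and> is_distribution W u \<and> smooth_on W h \<and>
        distributional_eq W (op_in_chart L c) u h \<longrightarrow>
        (\<exists>v. smooth_on W v \<and> (\<forall>\<phi> \<in> test_functions W. u \<phi> = (\<integral>x. v x * \<phi> x \<partial>lborel))))"


section \<open>Connections\<close>

text \<open>A connection acts on locally defined fields: \<open>nab X Y p\<close> is the value of \<open>\<nabla>\<^sub>X Y\<close> at \<open>p\<close>, for
  fields \<open>X\<close>, \<open>Y\<close> that are smooth near \<open>p\<close>.\<close>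

type_synonym ('a, 'e) connection = "('a \<Rightarrow> 'e) \<Rightarrow> ('a \<Rightarrow> 'e) \<Rightarrow> 'a \<Rightarrow> 'e"

definition is_connection ::
    "('a::topological_space, 'e::euclidean_space) foliated \<Rightarrow> ('a, 'e) connection \<Rightarrow> bool" where
  "is_connection M nab \<longleftrightarrow>
     (\<forall>U X Y X' Y' f. open U \<and> smooth_field_on M U X \<and> smooth_field_on M U Y \<and>
        smooth_field_on M U X' \<and> smooth_field_on M U Y' \<and> smooth_fun_on M U f \<longrightarrow>
        smooth_field_on M U (nab X Y) \<and>
        ((\<forall>p\<in>U. X p = X' p \<and> Y p = Y' p) \<longrightarrow> (\<forall>p\<in>U. nab X Y p = nab X' Y' p)) \<and>
        (\<forall>p\<in>U. nab (\<lambda>q. f q *\<^sub>R X q + X' q) Y p = f p *\<^sub>R nab X Y p + nab X' Y p) \<and>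
        (\<forall>p\<in>U. nab X (\<lambda>q. Y q + Y' q) p = nab X Y p + nab X Y' p) \<and>
        (\<forall>p\<in>U. nab X (\<lambda>q. f q *\<^sub>R Y q) p = f p *\<^sub>R nab X Y p + field_app M X f p *\<^sub>R Y p))"

definition is_metric_connection ::
    "('a::topological_space, 'e::euclidean_space) foliated \<Rightarrow> ('a, 'e) connection \<Rightarrow> bool" where
  "is_metric_connection M nab \<longleftrightarrow> is_connection M nab \<and>
     (\<forall>U X Y Z. open U \<and> smooth_field_on M U X \<and> smooth_field_on M U Y \<and> smooth_field_on M U Z \<longrightarrow>
        (\<forall>p\<in>U. field_app M X (\<lambda>q. gmetric M q (Y q) (Z q)) p =
           gmetric M p (nab X Y p) (Z p) + gmetric M p (Y p) (nab X Z p)))"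

definition torsion ::
    "('a, 'e::euclidean_space) foliated \<Rightarrow> ('a, 'e) connection \<Rightarrow>
     ('a \<Rightarrow> 'e) \<Rightarrow> ('a \<Rightarrow> 'e) \<Rightarrow> 'a \<Rightarrow> 'e" where
  "torsion M nab U V p = nab U V p - nab V U p - lie_bracket M U V p"

definition levi_civita ::
    "('a::topological_space, 'e::euclidean_space) foliated \<Rightarrow> ('a, 'e) connection \<Rightarrow> bool" where
  "levi_civita M D \<longleftrightarrow> is_metric_connection M D \<and>
     (\<forall>U X Y. open U \<and> smooth_field_on M U X \<and> smooth_field_on M U Y \<longrightarrow>
        (\<forall>p\<in>U. torsion M D X Y p = 0))"

text \<open>The parameter \<open>D\<close> is meant to be the Levi-Civita connection.\<close>

definition hladky_connection ::
    "('a::topological_space, 'e::euclidean_space) foliated \<Rightarrow> ('a, 'e) connection \<Rightarrow>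
     ('a, 'e) connection \<Rightarrow> bool" where
  "hladky_connection M D nab \<longleftrightarrow> is_metric_connection M nab \<and>
     (\<forall>S X V. open S \<and> smooth_field_on M S X \<and> smooth_field_on M S V \<longrightarrow>
        (horizontal_on M S V \<longrightarrow> horizontal_on M S (nab X V)) \<and>
        (vertical_on M S V \<longrightarrow> vertical_on M S (nab X V))) \<and>
     (\<forall>S U V. open S \<and> smooth_field_on M S U \<and> smooth_field_on M S V \<longrightarrow>
        (horizontal_on M S U \<and> horizontal_on M S V \<longrightarrow>
           (\<forall>p\<in>S. nab U V p = hproj M p (D U V p))) \<and>
        (vertical_on M S U \<and> vertical_on M S V \<longrightarrow>
           (\<forall>p\<in>S. nab U V p = vproj M p (D U V p)))) \<and>
     (\<forall>S F. adapted_frame M S F \<longrightarrow>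
        (\<forall>p\<in>S. \<forall>\<beta> \<in> leafdirs M. \<forall>j \<in> Basis - leafdirs M.
           nab (F \<beta>) (F j) p =
             (1/2) *\<^sub>R (\<Sum>k \<in> Basis - leafdirs M.
               (struct_const M F \<beta> j k p - struct_const M F \<beta> k j p) *\<^sub>R F k p) \<and>
           nab (F j) (F \<beta>) p =
             - (1/2) *\<^sub>R (\<Sum>\<alpha> \<in> leafdirs M.
               (struct_const M F \<beta> j \<alpha> p - struct_const M F \<alpha> j \<beta> p) *\<^sub>R F \<alpha> p)))"

definition curvature ::
    "('a, 'e::euclidean_space) foliated \<Rightarrow> ('a, 'e) connection \<Rightarrow>
     ('a \<Rightarrow> 'e) \<Rightarrow> ('a \<Rightarrow> 'e) \<Rightarrow> ('a \<Rightarrow> 'e) \<Rightarrow> 'a \<Rightarrow> 'e" where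
  "curvature M nab W U V p =
     nab W (nab U V) p - nab U (nab W V) p - nab (lie_bracket M W U) V p"

text \<open>The trace over \<open>W\<close> is computed in the basis \<open>Basis\<close> of the tangent space at \<open>p\<close>, whose vectors
  are extended to fields near \<open>p\<close>.\<close>

definition ricci ::
    "('a, 'e::euclidean_space) foliated \<Rightarrow> ('a, 'e) connection \<Rightarrow>
     ('a \<Rightarrow> 'e) \<Rightarrow> ('a \<Rightarrow> 'e) \<Rightarrow> 'a \<Rightarrow> real" where
  "ricci M nab U V p = (\<Sum>b \<in> Basis. curvature M nab (const_field M p b) U V p \<bullet> b)"

text \<open>\<open>\<nabla>Y(U, V)\<close>\<close>

definition cov_form ::
    "('a, 'e::euclidean_space) foliated \<Rightarrow> ('a, 'e) connection \<Rightarrow> ('a \<Rightarrow> 'e) \<Rightarrow>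
     ('a \<Rightarrow> 'e) \<Rightarrow> ('a \<Rightarrow> 'e) \<Rightarrow> 'a \<Rightarrow> real" where
  "cov_form M nab Y U V p = gmetric M p (nab U Y p) (V p)"

text \<open>Projecting both arguments extends \<open>\<langle>\<nabla>\<^sub>U \<nabla>\<^sub>V f, V\<rangle>\<close> bilinearly from vertical arguments by zero
  on horizontal ones.\<close>

definition vhessian ::
    "('a, 'e::euclidean_space) foliated \<Rightarrow> ('a, 'e) connection \<Rightarrow> ('a \<Rightarrow> real) \<Rightarrow>
     ('a \<Rightarrow> 'e) \<Rightarrow> ('a \<Rightarrow> 'e) \<Rightarrow> 'a \<Rightarrow> real" where
  "vhessian M nab f U V p =
     gmetric M p (nab (\<lambda>q. vproj M q (U q)) (vgrad M f) p) (vproj M p (V p))"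

text \<open>The squared Hilbert-Schmidt norm of a bilinear form \<open>h\<close> on the tangent space at \<open>p\<close>; it does
  not depend on the orthonormal basis \<open>e\<close>.\<close>

definition hs_norm_sq ::
    "('a, 'e::euclidean_space) foliated \<Rightarrow> 'a \<Rightarrow> ('e \<Rightarrow> 'e \<Rightarrow> real) \<Rightarrow> real" where
  "hs_norm_sq M p h =
     (let e = (SOME e :: 'e \<Rightarrow> 'e. \<forall>a \<in> Basis. \<forall>b \<in> Basis.
                 gmetric M p (e a) (e b) = (if a = b then 1 else 0))
      in \<Sum>a \<in> Basis. \<Sum>b \<in> Basis. (h (e a) (e b))\<^sup>2)"

definition vhessian_norm_sq ::
    "('a, 'e::euclidean_space) foliated \<Rightarrow> ('a, 'e) connection \<Rightarrow> ('a \<Rightarrow> real) \<Rightarrow> 'a \<Rightarrow> real" where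
  "vhessian_norm_sq M nab f p =
     hs_norm_sq M p (\<lambda>v w. vhessian M nab f (const_field M p v) (const_field M p w) p)"


section \<open>Carre du champ operators\<close>

definition \<Gamma> ::
    "('a, 'e::euclidean_space) foliated \<Rightarrow> ('a \<Rightarrow> real) \<Rightarrow> ('a \<Rightarrow> real) \<Rightarrow> 'a \<Rightarrow> real" where
  "\<Gamma> M f g p = gmetric M p (vgrad M f p) (vgrad M g p)"

definition \<Gamma>\<^sub>2 ::
    "('a, 'e::euclidean_space) foliated \<Rightarrow> (('a \<Rightarrow> real) \<Rightarrow> 'a \<Rightarrow> real) \<Rightarrow>
     ('a \<Rightarrow> real) \<Rightarrow> ('a \<Rightarrow> real) \<Rightarrow> 'a \<Rightarrow> real" where
  "\<Gamma>\<^sub>2 M L f g p = (1/2) * (L (\<Gamma> M f g) p - \<Gamma> M g (L f) p - \<Gamma> M f (L g) p)"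

end

theory Submission
  imports Defs
begin

text \<open>
  Write \<open>V\<close> for the vertical gradient of \<open>f\<close>.  The operator \<open>\<Gamma>\<^sub>2\<close> is linear in the generator, so the
  identity splits into one for the vertical Laplacian and one for the drift \<open>Y\<close>.

  The first is Bochner's formula on the leaves.  On vertical fields the Hladky connection is the
  projected Levi-Civita connection, and the vertical bundle is closed under brackets because
  transition maps preserve plaques; hence the connection has no torsion along the leaves
  (\<open>nab_vertical_torsion_free\<close>) and the vertical Hessian is symmetric (\<open>hessian_symmetric\<close>).  The
  vertical Laplacian is the trace of this Hessian (\<open>vlaplacian_trace\<close>), and symmetry gives
  \<open>\<nabla>\<^sub>\<V> \<bar>V\<bar>\<^sup>2 = 2 \<nabla>\<^sub>V V\<close>.  Comparing the trace of \<open>\<nabla> (\<nabla>\<^sub>V V)\<close> with the derivative of the trace of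
  \<open>\<nabla> V\<close> along \<open>V\<close> leaves exactly the curvature and the square of the Hessian, up to the rotation of
  the frame along \<open>V\<close>.  That rotation is antisymmetric, so it is invisible to the symmetric Hessian
  (\<open>bochner_leafwise\<close>).  Since the vertical bundle is parallel, \<open>R(W, V) V\<close> is vertical, and the
  full Ricci trace is a trace over the leaf (\<open>ricci_vertical_trace\<close>).

  The second is a commutator computation.  We have \<open>V f = \<bar>V\<bar>\<^sup>2\<close>, so that
  \<open>Y \<bar>V\<bar>\<^sup>2 / 2 - V (Y f) = [Y, V] f - Y \<bar>V\<bar>\<^sup>2 / 2\<close>; expressing the bracket by the connection and its
  torsion, the term \<open>\<langle>\<nabla>\<^sub>Y V, \<nabla> f\<rangle> = \<langle>\<nabla>\<^sub>Y V, V\<rangle>\<close> cancels against \<open>Y \<bar>V\<bar>\<^sup>2 / 2\<close> (\<open>drift_term\<close>).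

  Tangent vectors are represented in a chart that jumps from point to point, so everything is
  reduced to a single chart by the chain rule (\<open>chart_change\<close>).  Local adapted frames come from
  orthonormalising coordinate fields (\<open>adapted_frame_exists\<close>).
\<close>

section \<open>Calculus of smooth maps\<close>

text \<open>The two maps have the same derivatives at \<open>x\<close>, so the choice made by \<open>frechet_derivative\<close> is the
  same for both.\<close>

lemma frechet_derivative_cong_open:
  assumes "open S" "x \<in> S" "\<And>y. y \<in> S \<Longrightarrow> f y = g y"
  shows "frechet_derivative f (at x) = frechet_derivative g (at x)"
proof -
  have "(f has_derivative f') (at x) \<longleftrightarrow> (g has_derivative f') (at x)" for f'
    using has_derivative_transform_within_open[of f f' x UNIV S g]
      has_derivative_transform_within_open[of g f' x UNIV S f] assms by auto
  then show ?thesis unfolding frechet_derivative_def by simp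
qed

lemma differentiable_cong_open:
  assumes "open S" "x \<in> S" "\<And>y. y \<in> S \<Longrightarrow> f y = g y"
  shows "f differentiable at x \<longleftrightarrow> g differentiable at x"
  unfolding differentiable_def
  using has_derivative_transform_within_open[of f _ x UNIV S g]
      has_derivative_transform_within_open[of g _ x UNIV S f] assms by auto

lemma times_differentiable_cong:
  assumes "open S" "\<And>y. y \<in> S \<Longrightarrow> f y = g y" "times_differentiable k S f"
  shows "times_differentiable k S g"
  using assms(2,3)
proof (induction k arbitrary: f g)
  case 0
  then show ?case using continuous_on_cong[of S S f g] by simp
next
  case (Suc k)
  have "frechet_derivative f (at x) = frechet_derivative g (at x)" if "x \<in> S" for x
    using frechet_derivative_cong_open[OF assms(1) that] Suc.prems(1) by auto
  moreover have "g differentiable at x" if "x \<in> S" for x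
    using differentiable_cong_open[OF assms(1) that, of f g] Suc.prems that by auto
  ultimately show ?case using Suc.prems(2)
    by (auto intro: Suc.IH[of "\<lambda>x. frechet_derivative f (at x) _"])
qed

lemma times_differentiable_lower: "times_differentiable (Suc k) S f \<Longrightarrow> times_differentiable k S f"
proof (induction k arbitrary: f)
  case 0
  then have "f differentiable at x" if "x \<in> S" for x using that by simp
  then show ?case
    by (auto intro!: continuous_at_imp_continuous_on differentiable_imp_continuous_within)
next
  case (Suc k)
  then show ?case by (metis times_differentiable.simps(2))
qed

lemma times_differentiable_subset:
  "times_differentiable k S f \<Longrightarrow> T \<subseteq> S \<Longrightarrow> times_differentiable k T f"
  by (induction k arbitrary: f) (auto intro: continuous_on_subset)

text \<open>Each closure property of smooth maps is an induction on the order of differentiability, in which this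
  rule replaces the canonical derivative by the one that the product or chain rule produces.\<close>

lemma times_differentiable_SucI:
  assumes "open S" "\<And>x. x \<in> S \<Longrightarrow> (f has_derivative f' x) (at x)"
    and "\<And>v. times_differentiable k S (\<lambda>x. f' x v)"
  shows "times_differentiable (Suc k) S f"
proof -
  have "f' x = frechet_derivative f (at x)" if "x \<in> S" for x
    using assms(2)[OF that] by (rule frechet_derivative_at)
  then have "times_differentiable k S (\<lambda>x. frechet_derivative f (at x) v)" for v
    by (intro times_differentiable_cong[OF assms(1) _ assms(3)]) simp
  moreover have "\<forall>x\<in>S. f differentiable at x"
    using assms(2) by (auto simp: differentiable_def)
  ultimately show ?thesis by simp
qed

lemma times_differentiable_has_derivative:
  "times_differentiable (Suc k) S f \<Longrightarrow> x \<in> S \<Longrightarrow>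
    (f has_derivative frechet_derivative f (at x)) (at x)"
  by (simp add: frechet_derivative_works[symmetric])

lemma times_differentiable_partial:
  "times_differentiable (Suc k) S f \<Longrightarrow> times_differentiable k S (\<lambda>x. frechet_derivative f (at x) v)"
  by simp

lemma times_differentiable_const: "times_differentiable k S (\<lambda>x. c)"
  by (induction k arbitrary: c) auto

lemma times_differentiable_add:
  assumes "open S" "times_differentiable k S f" "times_differentiable k S g"
  shows "times_differentiable k S (\<lambda>x. f x + g x)"
  using assms(2,3)
proof (induction k arbitrary: f g)
  case 0
  then show ?case by (auto intro: continuous_on_add)
next
  case (Suc k)
  show ?case
  proof (rule times_differentiable_SucI[OF assms(1)])
    show "((\<lambda>x. f x + g x) has_derivative
        (\<lambda>v. frechet_derivative f (at x) v + frechet_derivative g (at x) v)) (at x)" if "x \<in> S" for x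
      using Suc.prems that by (intro has_derivative_add times_differentiable_has_derivative)
    show "times_differentiable k S
        (\<lambda>x. frechet_derivative f (at x) v + frechet_derivative g (at x) v)" for v
      using Suc.prems by (intro Suc.IH times_differentiable_partial)
  qed
qed

lemma times_differentiable_bilinear:
  assumes "open S" "bounded_bilinear bop" "times_differentiable k S f" "times_differentiable k S g"
  shows "times_differentiable k S (\<lambda>x. bop (f x) (g x))"
  using assms(3,4)
proof (induction k arbitrary: f g)
  case 0
  then show ?case using bounded_bilinear.continuous_on[OF assms(2)] by auto
next
  case (Suc k)
  show ?case
  proof (rule times_differentiable_SucI[OF assms(1)])
    show "((\<lambda>x. bop (f x) (g x)) has_derivative
        (\<lambda>v. bop (f x) (frechet_derivative g (at x) v) + bop (frechet_derivative f (at x) v) (g x))) (at x)"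
      if "x \<in> S" for x
      using Suc.prems that
      by (intro bounded_bilinear.FDERIV[OF assms(2)] times_differentiable_has_derivative)
    show "times_differentiable k S
      (\<lambda>x. bop (f x) (frechet_derivative g (at x) v) + bop (frechet_derivative f (at x) v) (g x))" for v
      using Suc.prems
      by (intro times_differentiable_add[OF assms(1)] Suc.IH times_differentiable_partial)
        (auto intro: times_differentiable_lower simp del: times_differentiable.simps)
  qed
qed

lemma times_differentiable_sum:
  assumes "open S" "\<And>i. i \<in> I \<Longrightarrow> times_differentiable k S (f i)"
  shows "times_differentiable k S (\<lambda>x. \<Sum>i\<in>I. f i x)"
  using assms(2)
  by (induction I rule: infinite_finite_induct)
     (auto intro!: times_differentiable_const times_differentiable_add[OF assms(1)])

lemma frechet_derivative_basis_sum:
  fixes f :: "'e::euclidean_space \<Rightarrow> 'b::real_normed_vector"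
  assumes "f differentiable at x"
  shows "frechet_derivative f (at x) v = (\<Sum>b\<in>Basis. (v \<bullet> b) *\<^sub>R frechet_derivative f (at x) b)"
proof -
  interpret fd: linear "frechet_derivative f (at x)"
    using assms by (rule linear_frechet_derivative)
  show ?thesis
    by (subst euclidean_representation[of v, symmetric]) (simp only: fd.sum fd.scale)
qed

lemma times_differentiable_compose:
  fixes f :: "'e::euclidean_space \<Rightarrow> 'd::euclidean_space"
  assumes "open S" "open T" "f ` S \<subseteq> T" "times_differentiable k S f" "times_differentiable k T g"
  shows "times_differentiable k S (g \<circ> f)"
  using assms(4,5)
proof (induction k arbitrary: g)
  case 0
  then show ?case
    using assms(3) continuous_on_compose[of S f g] continuous_on_subset[of T g "f ` S"] by simp
next
  case (Suc k)
  have fT: "f x \<in> T" if "x \<in> S" for x using that assms(3) by auto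
  let ?d = "\<lambda>x v. \<Sum>b\<in>Basis.
    (frechet_derivative f (at x) v \<bullet> b) *\<^sub>R ((\<lambda>y. frechet_derivative g (at y) b) \<circ> f) x"
  show ?case
  proof (rule times_differentiable_SucI[OF assms(1)])
    fix x assume x: "x \<in> S"
    have g: "(g has_derivative frechet_derivative g (at (f x))) (at (f x))"
      using Suc.prems(2) fT[OF x] by (rule times_differentiable_has_derivative)
    have "?d x = frechet_derivative g (at (f x)) \<circ> frechet_derivative f (at x)"
      using frechet_derivative_basis_sum[OF differentiableI[OF g], symmetric]
      by (simp add: fun_eq_iff)
    then show "(g \<circ> f has_derivative ?d x) (at x)"
      using diff_chain_at[OF times_differentiable_has_derivative[OF Suc.prems(1) x] g] by (simp only:)
  next
    fix v
    show "times_differentiable k S (\<lambda>x. ?d x v)"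
      using Suc.prems times_differentiable_lower[OF Suc.prems(1)]
      by (intro times_differentiable_sum[OF assms(1)] Suc.IH times_differentiable_const
          times_differentiable_bilinear[OF assms(1) bounded_bilinear_scaleR]
          times_differentiable_bilinear[OF assms(1) bounded_bilinear_inner]
          times_differentiable_partial)
  qed
qed

text \<open>The family \<open>c * x powr a\<close> is closed under differentiation, which makes the induction go through; the
  exponent \<open>-1/2\<close> is what normalising a vector field requires.\<close>

lemma times_differentiable_powr: "times_differentiable k {0<..} (\<lambda>x::real. c * x powr a)"
proof (induction k arbitrary: a c)
  case 0
  then show ?case by (auto intro!: continuous_intros)
next
  case (Suc k)
  show ?case
  proof (rule times_differentiable_SucI)
    show "((\<lambda>x. c * x powr a) has_derivative (\<lambda>v. (c * a * v) * x powr (a - 1))) (at x)"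
      if "x \<in> {0<..}" for x
      using that by (auto intro!: derivative_eq_intros simp: powr_diff)
  qed (use Suc in auto)
qed

text \<open>The step of the inductive definition, as a fixed-point property of smoothness.\<close>

lemma smooth_on_iff:
  "smooth_on S f \<longleftrightarrow>
     (\<forall>x\<in>S. f differentiable at x) \<and> (\<forall>v. smooth_on S (\<lambda>x. frechet_derivative f (at x) v))"
proof
  assume f: "smooth_on S f"
  then have "times_differentiable (Suc k) S f" for k unfolding smooth_on_def by blast
  then show "(\<forall>x\<in>S. f differentiable at x) \<and> (\<forall>v. smooth_on S (\<lambda>x. frechet_derivative f (at x) v))"
    unfolding smooth_on_def by auto
next
  assume *: "(\<forall>x\<in>S. f differentiable at x) \<and> (\<forall>v. smooth_on S (\<lambda>x. frechet_derivative f (at x) v))"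
  then have "times_differentiable (Suc k) S f" for k
    unfolding smooth_on_def by auto
  then show "smooth_on S f" unfolding smooth_on_def using times_differentiable_lower by blast
qed

lemma smooth_on_differentiable: "smooth_on S f \<Longrightarrow> x \<in> S \<Longrightarrow> f differentiable at x"
  using smooth_on_iff by blast

lemma smooth_on_partial: "smooth_on S f \<Longrightarrow> smooth_on S (\<lambda>x. frechet_derivative f (at x) v)"
  using smooth_on_iff by blast

lemma smooth_on_continuous: "smooth_on S f \<Longrightarrow> continuous_on S f"
  unfolding smooth_on_def using times_differentiable.simps(1) by blast

lemma smooth_on_subset: "smooth_on S f \<Longrightarrow> T \<subseteq> S \<Longrightarrow> smooth_on T f"
  unfolding smooth_on_def using times_differentiable_subset by blast

lemma smooth_on_cong:
  "open S \<Longrightarrow> (\<And>y. y \<in> S \<Longrightarrow> f y = g y) \<Longrightarrow> smooth_on S f \<Longrightarrow> smooth_on S g"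
  unfolding smooth_on_def using times_differentiable_cong by blast

lemma smooth_on_const: "smooth_on S (\<lambda>x. c)"
  unfolding smooth_on_def using times_differentiable_const by blast

lemma smooth_on_add:
  "open S \<Longrightarrow> smooth_on S f \<Longrightarrow> smooth_on S g \<Longrightarrow> smooth_on S (\<lambda>x. f x + g x)"
  unfolding smooth_on_def using times_differentiable_add by blast

lemma smooth_on_sum:
  "open S \<Longrightarrow> (\<And>i. i \<in> I \<Longrightarrow> smooth_on S (f i)) \<Longrightarrow> smooth_on S (\<lambda>x. \<Sum>i\<in>I. f i x)"
  unfolding smooth_on_def by (simp add: times_differentiable_sum)

lemma smooth_on_bilinear:
  assumes "open S" "bounded_bilinear bop" "smooth_on S f" "smooth_on S g"
  shows "smooth_on S (\<lambda>x. bop (f x) (g x))"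
  using times_differentiable_bilinear[OF assms(1,2)] assms(3,4) unfolding smooth_on_def by simp

lemmas smooth_on_scaleR = smooth_on_bilinear[OF _ bounded_bilinear_scaleR]
lemmas smooth_on_mult = smooth_on_bilinear[OF _ bounded_bilinear_mult]
lemmas smooth_on_inner = smooth_on_bilinear[OF _ bounded_bilinear_inner]

lemma smooth_on_compose:
  fixes f :: "'e::euclidean_space \<Rightarrow> 'd::euclidean_space"
  assumes "open S" "open T" "f ` S \<subseteq> T" "smooth_on S f" "smooth_on T g"
  shows "smooth_on S (g \<circ> f)"
  unfolding smooth_on_def
  using times_differentiable_compose[OF assms(1-3)] assms(4,5)[unfolded smooth_on_def] by blast

lemma smooth_on_powr:
  fixes f :: "'e::euclidean_space \<Rightarrow> real" and a :: real
  assumes "open S" "smooth_on S f" "\<And>x. x \<in> S \<Longrightarrow> f x > 0"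
  shows "smooth_on S (\<lambda>x. f x powr a)"
proof -
  have "smooth_on S ((\<lambda>y. 1 * y powr a) \<circ> f)"
    by (rule smooth_on_compose[where T = "{0<..}"])
      (use assms times_differentiable_powr[of _ 1 a] in \<open>auto simp: smooth_on_def\<close>)
  then show ?thesis by (simp add: o_def)
qed

lemma smooth_on_directional:
  fixes f :: "'e::euclidean_space \<Rightarrow> 'b::real_normed_vector"
  assumes "open S" "smooth_on S f" "smooth_on S v"
  shows "smooth_on S (\<lambda>x. frechet_derivative f (at x) (v x))"
proof (rule smooth_on_cong[OF assms(1)])
  show "(\<Sum>b\<in>Basis. (v x \<bullet> b) *\<^sub>R frechet_derivative f (at x) b) = frechet_derivative f (at x) (v x)"
    if "x \<in> S" for x
    using frechet_derivative_basis_sum[OF smooth_on_differentiable[OF assms(2) that], of "v x"] by simp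
  show "smooth_on S (\<lambda>x. \<Sum>b\<in>Basis. (v x \<bullet> b) *\<^sub>R frechet_derivative f (at x) b)"
    using assms
    by (intro smooth_on_sum smooth_on_scaleR smooth_on_inner smooth_on_const smooth_on_partial) auto
qed

lemma has_field_derivative_along_line:
  fixes f :: "'e::euclidean_space \<Rightarrow> real"
  assumes "f differentiable at (x + s *\<^sub>R u)"
  shows "((\<lambda>s. f (x + s *\<^sub>R u)) has_real_derivative frechet_derivative f (at (x + s *\<^sub>R u)) u) (at s)"
proof -
  have "((\<lambda>s. x + s *\<^sub>R u) has_derivative (\<lambda>t. t *\<^sub>R u)) (at s)"
    by (auto intro!: derivative_eq_intros)
  from diff_chain_at[OF this] assms[unfolded frechet_derivative_works]
  have "((\<lambda>s. f (x + s *\<^sub>R u)) has_derivative (\<lambda>t. frechet_derivative f (at (x + s *\<^sub>R u)) (t *\<^sub>R u))) (at s)"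
    by (simp add: o_def)
  then show ?thesis
    using linear_scale[OF linear_frechet_derivative[OF assms]]
    by (simp add: has_field_derivative_def mult_commute_abs)
qed

text \<open>Two applications of the mean value theorem turn the second difference of \<open>f\<close> over a small
  parallelogram into a mixed second derivative at a nearby point.  The second difference is symmetric
  in the two directions, which yields the symmetry of second derivatives.\<close>

lemma second_difference_mean_value:
  fixes f :: "'e::euclidean_space \<Rightarrow> real"
  assumes "smooth_on S f" "h > 0"
    and S: "\<And>s t. 0 \<le> s \<Longrightarrow> s \<le> h \<Longrightarrow> 0 \<le> t \<Longrightarrow> t \<le> h \<Longrightarrow> x + s *\<^sub>R u + t *\<^sub>R v \<in> S"
  obtains s t where "0 < s" "s < h" "0 < t" "t < h"
    "f (x + h *\<^sub>R u + h *\<^sub>R v) - f (x + h *\<^sub>R u) - f (x + h *\<^sub>R v) + f x =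
      h\<^sup>2 * frechet_derivative (\<lambda>y. frechet_derivative f (at y) u) (at (x + s *\<^sub>R u + t *\<^sub>R v)) v"
proof -
  let ?D = "\<lambda>y. frechet_derivative f (at y) u"
  define \<phi> where "\<phi> s = f ((x + h *\<^sub>R v) + s *\<^sub>R u) - f (x + s *\<^sub>R u)" for s
  have \<phi>: "(\<phi> has_real_derivative ?D ((x + h *\<^sub>R v) + s *\<^sub>R u) - ?D (x + s *\<^sub>R u)) (at s)"
    if "0 \<le> s" "s \<le> h" for s
    unfolding \<phi>_def using that S[of s h] S[of s 0] \<open>h > 0\<close>
    by (intro DERIV_diff has_field_derivative_along_line smooth_on_differentiable[OF assms(1)])
      (auto simp: algebra_simps)
  obtain s where s: "0 < s" "s < h"
    and 1: "\<phi> h - \<phi> 0 = (h - 0) * (?D ((x + h *\<^sub>R v) + s *\<^sub>R u) - ?D (x + s *\<^sub>R u))"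
    using MVT2[OF \<open>h > 0\<close> \<phi>] by blast
  have \<psi>: "((\<lambda>t. ?D ((x + s *\<^sub>R u) + t *\<^sub>R v)) has_real_derivative
      frechet_derivative ?D (at ((x + s *\<^sub>R u) + t *\<^sub>R v)) v) (at t)" if "0 \<le> t" "t \<le> h" for t
    using that S[of s t] s
    by (intro has_field_derivative_along_line smooth_on_differentiable[OF smooth_on_partial[OF assms(1)]])
       auto
  obtain t where t: "0 < t" "t < h"
    and 2: "?D ((x + s *\<^sub>R u) + h *\<^sub>R v) - ?D ((x + s *\<^sub>R u) + 0 *\<^sub>R v) =
      (h - 0) * frechet_derivative ?D (at ((x + s *\<^sub>R u) + t *\<^sub>R v)) v"
    using MVT2[OF \<open>h > 0\<close> \<psi>] by blast
  have "\<phi> h - \<phi> 0 = h\<^sup>2 * frechet_derivative ?D (at (x + s *\<^sub>R u + t *\<^sub>R v)) v"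
    using 1 2 by (simp add: algebra_simps power2_eq_square)
  moreover have "\<phi> h - \<phi> 0 = f (x + h *\<^sub>R u + h *\<^sub>R v) - f (x + h *\<^sub>R u) - f (x + h *\<^sub>R v) + f x"
    unfolding \<phi>_def by (simp add: algebra_simps)
  ultimately show ?thesis using that s t by simp
qed

lemma second_derivative_symmetric:
  fixes f :: "'e::euclidean_space \<Rightarrow> real"
  assumes S: "open S" "smooth_on S f" and x: "x \<in> S"
  shows "frechet_derivative (\<lambda>y. frechet_derivative f (at y) u) (at x) v =
    frechet_derivative (\<lambda>y. frechet_derivative f (at y) v) (at x) u"
proof -
  define A where "A u v y = frechet_derivative (\<lambda>z. frechet_derivative f (at z) u) (at y) v" for u v y
  have "\<bar>A u v x - A v u x\<bar> \<le> e" if "e > 0" for e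
  proof -
    have cont: "continuous_on S (A u v)" for u v
      unfolding A_def by (intro smooth_on_continuous smooth_on_partial S(2))
    have "\<exists>d>0. ball x d \<subseteq> S \<and> (\<forall>y\<in>ball x d. \<bar>A u v y - A u v x\<bar> < e/2)" for u v
    proof -
      obtain d1 where "d1 > 0" "\<forall>y\<in>S. dist y x < d1 \<longrightarrow> dist (A u v y) (A u v x) < e/2"
        using cont[of u v, unfolded continuous_on_iff] x \<open>e > 0\<close> by (meson half_gt_zero)
      moreover obtain d2 where "d2 > 0" "ball x d2 \<subseteq> S" using S(1) x open_contains_ball by blast
      ultimately show ?thesis
        by (intro exI[of _ "min d1 d2"] conjI ballI)
          (auto simp: dist_commute dist_real_def subset_iff)
    qed
    note near = this
    obtain d1 where d1: "d1 > 0" "ball x d1 \<subseteq> S" "\<forall>y\<in>ball x d1. \<bar>A u v y - A u v x\<bar> < e/2"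
      using near[of u v] by blast
    obtain d2 where d2: "d2 > 0" "ball x d2 \<subseteq> S" "\<forall>y\<in>ball x d2. \<bar>A v u y - A v u x\<bar> < e/2"
      using near[of v u] by blast
    define d where "d = min d1 d2"
    have "d > 0" using d1 d2 d_def by simp
    \<comment> \<open>small enough for the parallelogram spanned by \<open>h u\<close> and \<open>h v\<close> to lie in the ball of radius \<open>d\<close>\<close>
    define h where "h = d / (2 * (norm u + norm v + 1))"
    have pos: "norm u + norm v + 1 > 0" by (simp add: add_nonneg_pos)
    have h: "h > 0" unfolding h_def using \<open>d > 0\<close> pos by simp
    have hd: "h * (norm u + norm v + 1) = d/2" unfolding h_def using pos by (simp add: field_simps)
    have inb: "x + s *\<^sub>R u + t *\<^sub>R v \<in> ball x d" if "0 \<le> s" "s \<le> h" "0 \<le> t" "t \<le> h" for s t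
    proof -
      have "norm (s *\<^sub>R u + t *\<^sub>R v) \<le> s * norm u + t * norm v"
        using norm_triangle_ineq[of "s *\<^sub>R u" "t *\<^sub>R v"] that by simp
      also have "\<dots> \<le> h * norm u + h * norm v"
        using that by (intro add_mono mult_right_mono) auto
      also have "\<dots> < d" using hd h \<open>d > 0\<close> by (simp add: algebra_simps)
      finally have "norm (x - (x + s *\<^sub>R u + t *\<^sub>R v)) < d"
        by (metis (no_types, lifting) add.assoc add_diff_cancel_left' norm_minus_commute)
      then show ?thesis by (simp add: dist_norm)
    qed
    have inb': "x + s *\<^sub>R v + t *\<^sub>R u \<in> ball x d" if "0 \<le> s" "s \<le> h" "0 \<le> t" "t \<le> h" for s t
      using inb[of t s] that by (simp add: add.assoc add.commute[of "s *\<^sub>R v"])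
    have sub: "ball x d \<subseteq> S" using d1 unfolding d_def by auto
    obtain s t where st: "0 < s" "s < h" "0 < t" "t < h"
      "f (x + h *\<^sub>R u + h *\<^sub>R v) - f (x + h *\<^sub>R u) - f (x + h *\<^sub>R v) + f x =
       h\<^sup>2 * A u v (x + s *\<^sub>R u + t *\<^sub>R v)"
      using second_difference_mean_value[OF S(2) h, of x u v] inb sub unfolding A_def by blast
    obtain s' t' where st': "0 < s'" "s' < h" "0 < t'" "t' < h"
      "f (x + h *\<^sub>R v + h *\<^sub>R u) - f (x + h *\<^sub>R v) - f (x + h *\<^sub>R u) + f x =
       h\<^sup>2 * A v u (x + s' *\<^sub>R v + t' *\<^sub>R u)"
      using second_difference_mean_value[OF S(2) h, of x v u] inb' sub unfolding A_def by blast
    have swap: "x + h *\<^sub>R v + h *\<^sub>R u = x + h *\<^sub>R u + h *\<^sub>R v" by simp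
    have "h\<^sup>2 * A u v (x + s *\<^sub>R u + t *\<^sub>R v) = h\<^sup>2 * A v u (x + s' *\<^sub>R v + t' *\<^sub>R u)"
      using st(5) st'(5)[unfolded swap] by linarith
    then have eq: "A u v (x + s *\<^sub>R u + t *\<^sub>R v) = A v u (x + s' *\<^sub>R v + t' *\<^sub>R u)"
      using h by simp
    have "\<bar>A u v (x + s *\<^sub>R u + t *\<^sub>R v) - A u v x\<bar> < e/2"
      using inb[of s t] st d1(3) unfolding d_def by auto
    moreover have "\<bar>A v u (x + s' *\<^sub>R v + t' *\<^sub>R u) - A v u x\<bar> < e/2"
      using inb'[of s' t'] st' d2(3) unfolding d_def by auto
    ultimately show ?thesis using eq by linarith
  qed
  then have "\<bar>A u v x - A v u x\<bar> \<le> 0" by (rule field_le_epsilon[of _ 0, simplified])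
  then show ?thesis unfolding A_def by simp
qed

text \<open>The product rule for \<open>df(v)\<close>, with \<open>f\<close> and \<open>v\<close> both varying.\<close>

lemma frechet_derivative_directional:
  fixes f :: "'e::euclidean_space \<Rightarrow> real"
  assumes "smooth_on S f" "smooth_on S v" "open S" "x \<in> S"
  shows "frechet_derivative (\<lambda>y. frechet_derivative f (at y) (v y)) (at x) w =
    frechet_derivative f (at x) (frechet_derivative v (at x) w) +
    frechet_derivative (\<lambda>y. frechet_derivative f (at y) (v x)) (at x) w"
proof -
  let ?p = "\<lambda>b y. frechet_derivative f (at y) b"
  have f: "f differentiable at y" if "y \<in> S" for y using smooth_on_differentiable[OF assms(1) that] .
  have p: "(?p b has_derivative frechet_derivative (?p b) (at x)) (at x)" for b
    using smooth_on_differentiable[OF smooth_on_partial[OF assms(1)] assms(4)] frechet_derivative_works by blast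
  have v: "((\<lambda>y. v y \<bullet> b) has_derivative (\<lambda>w. frechet_derivative v (at x) w \<bullet> b)) (at x)" for b
    using smooth_on_differentiable[OF assms(2,4)] unfolding frechet_derivative_works
    by (rule has_derivative_inner_left)
  have sum: "((\<lambda>y. \<Sum>b\<in>Basis. u y b * ?p b y) has_derivative
     (\<lambda>w. \<Sum>b\<in>Basis. u x b * frechet_derivative (?p b) (at x) w + u' w b * ?p b x)) (at x)"
    if "\<And>b. ((\<lambda>y. u y b) has_derivative (\<lambda>w. u' w b)) (at x)" for u u'
    by (intro has_derivative_sum has_derivative_mult that p)
  have rep: "frechet_derivative (\<lambda>y. frechet_derivative f (at y) (u y)) (at x) =
      frechet_derivative (\<lambda>y. \<Sum>b\<in>Basis. (u y \<bullet> b) * ?p b y) (at x)" for u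
    by (intro frechet_derivative_cong_open[OF assms(3,4)]
        frechet_derivative_basis_sum[OF f, unfolded real_scaleR_def])
  have "frechet_derivative (\<lambda>y. frechet_derivative f (at y) (v y)) (at x) w =
      (\<Sum>b\<in>Basis. (v x \<bullet> b) * frechet_derivative (?p b) (at x) w + (frechet_derivative v (at x) w \<bullet> b) * ?p b x)"
    unfolding rep frechet_derivative_at[OF sum[OF v], symmetric] ..
  moreover have "frechet_derivative (\<lambda>y. frechet_derivative f (at y) (v x)) (at x) w =
      (\<Sum>b\<in>Basis. (v x \<bullet> b) * frechet_derivative (?p b) (at x) w + 0 * ?p b x)"
    unfolding rep[of "\<lambda>_. v x"] frechet_derivative_at[OF sum[OF has_derivative_const], symmetric] ..
  moreover have "frechet_derivative f (at x) (frechet_derivative v (at x) w) =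
      (\<Sum>b\<in>Basis. (frechet_derivative v (at x) w \<bullet> b) * ?p b x)"
    by (rule frechet_derivative_basis_sum[OF f[OF assms(4)], unfolded real_scaleR_def])
  ultimately show ?thesis by (simp add: sum.distrib)
qed

section \<open>Charts, tangent vectors and directional derivatives\<close>

locale foliated_manifold =
  fixes M :: "('a::{t2_space, second_countable_topology}, 'e::euclidean_space) foliated"
    and n m :: nat
  assumes foliated_riemannian: "foliated_riemannian_manifold n m M"
begin

lemma chart_at_in_atlas: "chart_at M p \<in> atlas M" and in_chart_at: "p \<in> cdom (chart_at M p)"
proof -
  have "\<exists>c. c \<in> atlas M \<and> p \<in> cdom c"
    using foliated_riemannian unfolding foliated_riemannian_manifold_def by blast
  from someI_ex[OF this] show "chart_at M p \<in> atlas M" "p \<in> cdom (chart_at M p)"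
    unfolding chart_at_def by auto
qed

lemma atlas_is_chart: "c \<in> atlas M \<Longrightarrow> is_chart c"
  using foliated_riemannian unfolding foliated_riemannian_manifold_def by blast

lemma open_cdom: "c \<in> atlas M \<Longrightarrow> open (cdom c)"
  using atlas_is_chart unfolding is_chart_def by blast

lemma cinv_cmap: "c \<in> atlas M \<Longrightarrow> q \<in> cdom c \<Longrightarrow> cinv c (cmap c q) = q"
  using atlas_is_chart[of c] unfolding is_chart_def homeomorphism_def by blast

lemma open_chart_image: "c \<in> atlas M \<Longrightarrow> open U \<Longrightarrow> open (cmap c ` (U \<inter> cdom c))"
  using atlas_is_chart[of c] homeomorphism_imp_open_map[of "cdom c" "cmap c ` cdom c" "cmap c" "cinv c" "U \<inter> cdom c"]
  unfolding is_chart_def by (auto simp: openin_open_eq Int_commute)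

lemma smooth_transition_atlas:
  "c \<in> atlas M \<Longrightarrow> c' \<in> atlas M \<Longrightarrow>
    smooth_on (cmap c ` (cdom c' \<inter> cdom c)) (cmap c' \<circ> cinv c)"
  using foliated_riemannian unfolding foliated_riemannian_manifold_def smooth_transition_def
  by (simp add: Int_commute)

text \<open>The chain rule for the transition map, applied to \<open>h\<close> read in two charts.  With \<open>h\<close> a chart it yields
  the cocycle rule for coordinates of tangent vectors, and with \<open>h\<close> a function it shows that
  directional derivatives can be computed in any chart.\<close>

lemma chart_change:
  fixes h :: "'a \<Rightarrow> 'b::real_normed_vector"
  assumes c: "c \<in> atlas M" "p \<in> cdom c" and c': "c' \<in> atlas M" "p \<in> cdom c'"
    and h: "(h \<circ> cinv c') differentiable at (cmap c' p)"
  shows "(h \<circ> cinv c) differentiable at (cmap c p)"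
    and "frechet_derivative (h \<circ> cinv c) (at (cmap c p)) v =
      frechet_derivative (h \<circ> cinv c') (at (cmap c' p))
        (frechet_derivative (cmap c' \<circ> cinv c) (at (cmap c p)) v)"
proof -
  let ?S = "cmap c ` (cdom c' \<inter> cdom c)" and ?t = "cmap c' \<circ> cinv c"
  have S: "open ?S" "cmap c p \<in> ?S" using c c' by (auto intro!: open_chart_image open_cdom)
  have eq: "(h \<circ> cinv c) y = ((h \<circ> cinv c') \<circ> ?t) y" if "y \<in> ?S" for y
    using that c c' by (auto simp: cinv_cmap)
  have t: "?t differentiable at (cmap c p)"
    using smooth_on_differentiable[OF smooth_transition_atlas[OF c(1) c'(1)] S(2)] .
  have h': "(h \<circ> cinv c') differentiable at (?t (cmap c p))"
    using h c by (simp add: cinv_cmap)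
  show "(h \<circ> cinv c) differentiable at (cmap c p)"
    using differentiable_cong_open[OF S, of "h \<circ> cinv c", OF eq] differentiable_chain_at[OF t h']
    by (simp only:)
  have "frechet_derivative (h \<circ> cinv c) (at (cmap c p)) =
      frechet_derivative ((h \<circ> cinv c') \<circ> ?t) (at (cmap c p))"
    by (rule frechet_derivative_cong_open[OF S eq])
  also have "\<dots> = frechet_derivative (h \<circ> cinv c') (at (?t (cmap c p))) \<circ> frechet_derivative ?t (at (cmap c p))"
    by (rule frechet_derivative_compose[OF t h'])
  finally show "frechet_derivative (h \<circ> cinv c) (at (cmap c p)) v =
      frechet_derivative (h \<circ> cinv c') (at (cmap c' p)) (frechet_derivative ?t (at (cmap c p)) v)"
    using c by (simp add: cinv_cmap)
qed

lemma transition_differentiable: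
  assumes "c \<in> atlas M" "p \<in> cdom c" "c' \<in> atlas M" "p \<in> cdom c'"
  shows "(cmap c' \<circ> cinv c) differentiable at (cmap c p)"
  using smooth_on_differentiable[OF smooth_transition_atlas[OF assms(1,3)]] assms(2,4) by auto

lemma linear_to_coord: "c \<in> atlas M \<Longrightarrow> p \<in> cdom c \<Longrightarrow> linear (to_coord M c p)"
  using linear_frechet_derivative[OF transition_differentiable[OF chart_at_in_atlas in_chart_at]]
  unfolding to_coord_def by (simp add: eta_contract_eq)

lemma linear_of_coord: "c \<in> atlas M \<Longrightarrow> p \<in> cdom c \<Longrightarrow> linear (of_coord M c p)"
  using linear_frechet_derivative[OF transition_differentiable[OF _ _ chart_at_in_atlas in_chart_at]]
  unfolding of_coord_def by (simp add: eta_contract_eq)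

lemma to_coord_change:
  assumes "c \<in> atlas M" "p \<in> cdom c" "c' \<in> atlas M" "p \<in> cdom c'"
  shows "to_coord M c' p v =
    frechet_derivative (cmap c' \<circ> cinv c) (at (cmap c p)) (to_coord M c p v)"
  unfolding to_coord_def
  by (rule chart_change(2)[OF chart_at_in_atlas in_chart_at assms(1,2) transition_differentiable[OF assms]])

lemma frechet_derivative_chart_id:
  assumes "c \<in> atlas M" "p \<in> cdom c"
  shows "frechet_derivative (cmap c \<circ> cinv c) (at (cmap c p)) v = v"
proof -
  have "frechet_derivative (cmap c \<circ> cinv c) (at (cmap c p)) = frechet_derivative (\<lambda>y. y) (at (cmap c p))"
    by (rule frechet_derivative_cong_open[of "cmap c ` (UNIV \<inter> cdom c)"])
      (use assms open_chart_image[OF assms(1) open_UNIV] in \<open>auto simp: cinv_cmap\<close>)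
  then show ?thesis by simp
qed

lemma to_coord_of_coord:
  assumes "c \<in> atlas M" "p \<in> cdom c"
  shows "to_coord M c p (of_coord M c p v) = v"
  using chart_change(2)[OF assms chart_at_in_atlas in_chart_at
      transition_differentiable[OF chart_at_in_atlas in_chart_at assms], of v]
    frechet_derivative_chart_id[OF assms]
  unfolding to_coord_def of_coord_def by simp

lemma of_coord_to_coord:
  assumes "c \<in> atlas M" "p \<in> cdom c"
  shows "of_coord M c p (to_coord M c p v) = v"
  using chart_change(2)[OF chart_at_in_atlas in_chart_at assms
      transition_differentiable[OF assms chart_at_in_atlas in_chart_at], of v]
    frechet_derivative_chart_id[OF chart_at_in_atlas in_chart_at, of p v]
  unfolding to_coord_def of_coord_def by simp

lemma to_coord_chart_at: "to_coord M (chart_at M p) p v = v"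
  unfolding to_coord_def by (rule frechet_derivative_chart_id[OF chart_at_in_atlas in_chart_at])

lemma of_coord_chart_at: "of_coord M (chart_at M p) p v = v"
  unfolding of_coord_def by (rule frechet_derivative_chart_id[OF chart_at_in_atlas in_chart_at])

section \<open>Smooth functions and fields\<close>

lemma smooth_fun_onD: "smooth_fun_on M U f \<Longrightarrow> c \<in> atlas M \<Longrightarrow> smooth_on (cmap c ` (U \<inter> cdom c)) (f \<circ> cinv c)"
  unfolding smooth_fun_on_def by blast

lemma smooth_field_onD:
  "smooth_field_on M U X \<Longrightarrow> c \<in> atlas M \<Longrightarrow> smooth_on (cmap c ` (U \<inter> cdom c)) (field_rep M c X)"
  unfolding smooth_field_on_def by blast

lemma smooth_fun_differentiable:
  assumes "smooth_fun_on M U f" "p \<in> U" "c \<in> atlas M" "p \<in> cdom c"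
  shows "(f \<circ> cinv c) differentiable at (cmap c p)"
  using smooth_on_differentiable[OF smooth_fun_onD[OF assms(1,3)]] assms by auto

lemma dir_deriv_chart:
  assumes "smooth_fun_on M U f" "p \<in> U" "c \<in> atlas M" "p \<in> cdom c"
  shows "dir_deriv M f p v = frechet_derivative (f \<circ> cinv c) (at (cmap c p)) (to_coord M c p v)"
  unfolding dir_deriv_def to_coord_def
  by (rule chart_change(2)[OF chart_at_in_atlas in_chart_at assms(3,4) smooth_fun_differentiable[OF assms]])

lemma smooth_fun_subset: "smooth_fun_on M U f \<Longrightarrow> W \<subseteq> U \<Longrightarrow> smooth_fun_on M W f"
  unfolding smooth_fun_on_def by (meson Int_mono image_mono order_refl smooth_on_subset)

lemma smooth_field_subset: "smooth_field_on M U X \<Longrightarrow> W \<subseteq> U \<Longrightarrow> smooth_field_on M W X"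
  unfolding smooth_field_on_def by (meson Int_mono image_mono order_refl smooth_on_subset)

lemma smooth_fun_cong:
  assumes "open U" "\<And>q. q \<in> U \<Longrightarrow> f q = h q" "smooth_fun_on M U f"
  shows "smooth_fun_on M U h"
  unfolding smooth_fun_on_def
proof
  fix c assume c: "c \<in> atlas M"
  show "smooth_on (cmap c ` (U \<inter> cdom c)) (h \<circ> cinv c)"
    by (rule smooth_on_cong[OF open_chart_image[OF c assms(1)] _ smooth_fun_onD[OF assms(3) c]])
      (auto simp: cinv_cmap[OF c] assms(2))
qed

lemma smooth_field_cong:
  assumes "open U" "\<And>q. q \<in> U \<Longrightarrow> X q = Z q" "smooth_field_on M U X"
  shows "smooth_field_on M U Z"
  unfolding smooth_field_on_def
proof
  fix c assume c: "c \<in> atlas M"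
  show "smooth_on (cmap c ` (U \<inter> cdom c)) (field_rep M c Z)"
    by (rule smooth_on_cong[OF open_chart_image[OF c assms(1)] _ smooth_field_onD[OF assms(3) c]])
      (auto simp: cinv_cmap[OF c] assms(2) field_rep_def)
qed

lemma smooth_fun_const: "smooth_fun_on M U (\<lambda>q. r)"
  unfolding smooth_fun_on_def by (simp add: o_def smooth_on_const)

lemma smooth_fun_add:
  "open U \<Longrightarrow> smooth_fun_on M U f \<Longrightarrow> smooth_fun_on M U h \<Longrightarrow> smooth_fun_on M U (\<lambda>q. f q + h q)"
  unfolding smooth_fun_on_def o_def by (auto intro!: smooth_on_add open_chart_image)

lemma smooth_fun_sum:
  "open U \<Longrightarrow> (\<And>i. i \<in> I \<Longrightarrow> smooth_fun_on M U (f i)) \<Longrightarrow> smooth_fun_on M U (\<lambda>q. \<Sum>i\<in>I. f i q)"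
  unfolding smooth_fun_on_def o_def by (auto intro!: smooth_on_sum open_chart_image)

lemma smooth_fun_powr:
  assumes "open U" "smooth_fun_on M U f" "\<And>q. q \<in> U \<Longrightarrow> f q > 0"
  shows "smooth_fun_on M U (\<lambda>q. f q powr r)"
  unfolding smooth_fun_on_def
proof
  fix c assume c: "c \<in> atlas M"
  have "smooth_on (cmap c ` (U \<inter> cdom c)) (\<lambda>y. (f \<circ> cinv c) y powr r)"
    by (rule smooth_on_powr[OF open_chart_image[OF c assms(1)] smooth_fun_onD[OF assms(2) c]])
      (auto simp: cinv_cmap[OF c] assms(3))
  then show "smooth_on (cmap c ` (U \<inter> cdom c)) ((\<lambda>q. f q powr r) \<circ> cinv c)"
    by (simp add: o_def)
qed

lemma smooth_field_add:
  assumes "open U" "smooth_field_on M U X" "smooth_field_on M U Z"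
  shows "smooth_field_on M U (\<lambda>q. X q + Z q)"
  unfolding smooth_field_on_def
proof
  fix c assume c: "c \<in> atlas M"
  show "smooth_on (cmap c ` (U \<inter> cdom c)) (field_rep M c (\<lambda>q. X q + Z q))"
    by (rule smooth_on_cong[OF open_chart_image[OF c assms(1)] _
      smooth_on_add[OF open_chart_image[OF c assms(1)] smooth_field_onD[OF assms(2) c] smooth_field_onD[OF assms(3) c]]])
      (auto simp: cinv_cmap[OF c] field_rep_def linear_add[OF linear_to_coord[OF c]])
qed

lemma smooth_field_scale:
  assumes "open U" "smooth_fun_on M U f" "smooth_field_on M U Z"
  shows "smooth_field_on M U (\<lambda>q. f q *\<^sub>R Z q)"
  unfolding smooth_field_on_def
proof
  fix c assume c: "c \<in> atlas M"
  show "smooth_on (cmap c ` (U \<inter> cdom c)) (field_rep M c (\<lambda>q. f q *\<^sub>R Z q))"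
    by (rule smooth_on_cong[OF open_chart_image[OF c assms(1)] _
      smooth_on_scaleR[OF open_chart_image[OF c assms(1)] smooth_fun_onD[OF assms(2) c] smooth_field_onD[OF assms(3) c]]])
      (auto simp: cinv_cmap[OF c] field_rep_def linear_scale[OF linear_to_coord[OF c]])
qed

lemma smooth_field_zero: "open U \<Longrightarrow> smooth_field_on M U (\<lambda>q. 0)"
proof -
  assume U: "open U"
  have "smooth_on (cmap c ` (U \<inter> cdom c)) (field_rep M c (\<lambda>q. 0))" if c: "c \<in> atlas M" for c
    by (rule smooth_on_cong[OF open_chart_image[OF c U] _ smooth_on_const[of _ 0]])
      (auto simp: cinv_cmap[OF c] field_rep_def linear_0[OF linear_to_coord[OF c]])
  then show ?thesis unfolding smooth_field_on_def by blast
qed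

lemma smooth_field_sum:
  assumes "open U" "\<And>i. i \<in> I \<Longrightarrow> smooth_field_on M U (X i)"
  shows "smooth_field_on M U (\<lambda>q. \<Sum>i\<in>I. X i q)"
  using assms(2)
  by (induction I rule: infinite_finite_induct)
    (auto intro!: smooth_field_zero smooth_field_add assms(1))

lemma smooth_field_diff:
  assumes "open U" "smooth_field_on M U X" "smooth_field_on M U Z"
  shows "smooth_field_on M U (\<lambda>q. X q - Z q)"
  using smooth_field_add[OF assms(1,2) smooth_field_scale[OF assms(1) smooth_fun_const[of U "-1"] assms(3)]]
  by simp

text \<open>Although \<open>field_app\<close> uses a different chart at every point, it is given by one formula throughout the
  domain of a fixed chart, so it can be differentiated there.\<close>

lemma field_app_chart:
  assumes "smooth_fun_on M U f" "c \<in> atlas M" "y \<in> cmap c ` (U \<inter> cdom c)"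
  shows "field_app M X f (cinv c y) = frechet_derivative (f \<circ> cinv c) (at y) (field_rep M c X y)"
  using assms dir_deriv_chart[OF assms(1) _ assms(2)]
  unfolding field_app_def field_rep_def by (auto simp: cinv_cmap)

lemma smooth_field_app:
  assumes U: "open U" and X: "smooth_field_on M U X" and f: "smooth_fun_on M U f"
  shows "smooth_fun_on M U (field_app M X f)"
  unfolding smooth_fun_on_def
proof
  fix c assume c: "c \<in> atlas M"
  show "smooth_on (cmap c ` (U \<inter> cdom c)) (field_app M X f \<circ> cinv c)"
    by (rule smooth_on_cong[OF open_chart_image[OF c U] _
      smooth_on_directional[OF open_chart_image[OF c U] smooth_fun_onD[OF f c] smooth_field_onD[OF X c]]])
      (simp add: field_app_chart[OF f c])
qed

lemma has_derivative_in_chart: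
  assumes "smooth_fun_on M U f" "p \<in> U"
  shows "((f \<circ> cinv (chart_at M p)) has_derivative dir_deriv M f p) (at (cmap (chart_at M p) p))"
  using smooth_fun_differentiable[OF assms chart_at_in_atlas in_chart_at]
  unfolding dir_deriv_def frechet_derivative_works by simp

lemma dir_derivI:
  "((f \<circ> cinv (chart_at M p)) has_derivative f') (at (cmap (chart_at M p) p)) \<Longrightarrow> dir_deriv M f p v = f' v"
  unfolding dir_deriv_def using frechet_derivative_at by metis

lemma linear_dir_deriv: "smooth_fun_on M U f \<Longrightarrow> p \<in> U \<Longrightarrow> linear (dir_deriv M f p)"
  using has_derivative_in_chart has_derivative_linear by blast

lemma dir_deriv_cong:
  assumes "open U" "p \<in> U" "\<And>q. q \<in> U \<Longrightarrow> f q = h q"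
  shows "dir_deriv M f p v = dir_deriv M h p v"
proof -
  let ?c = "chart_at M p"
  have "frechet_derivative (f \<circ> cinv ?c) (at (cmap ?c p)) = frechet_derivative (h \<circ> cinv ?c) (at (cmap ?c p))"
    by (rule frechet_derivative_cong_open[of "cmap ?c ` (U \<inter> cdom ?c)"])
      (use assms open_chart_image chart_at_in_atlas in_chart_at in \<open>auto simp: cinv_cmap\<close>)
  then show ?thesis unfolding dir_deriv_def by simp
qed

lemma dir_deriv_const: "dir_deriv M (\<lambda>q. r) p v = 0"
  by (rule dir_derivI) (simp add: o_def)

lemma dir_deriv_add:
  assumes "smooth_fun_on M U f" "smooth_fun_on M U h" "p \<in> U"
  shows "dir_deriv M (\<lambda>q. f q + h q) p v = dir_deriv M f p v + dir_deriv M h p v"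
  using has_derivative_add[OF has_derivative_in_chart[OF assms(1,3)] has_derivative_in_chart[OF assms(2,3)]]
  by (intro dir_derivI) (simp add: o_def)

lemma dir_deriv_sum:
  assumes "open U" "\<And>i. i \<in> I \<Longrightarrow> smooth_fun_on M U (f i)" "p \<in> U"
  shows "dir_deriv M (\<lambda>q. \<Sum>i\<in>I. f i q) p v = (\<Sum>i\<in>I. dir_deriv M (f i) p v)"
  using assms(2)
  by (induction I rule: infinite_finite_induct)
    (auto simp: dir_deriv_const dir_deriv_add[OF _ smooth_fun_sum[OF assms(1)] assms(3)])

text \<open>The bracket, defined by components in a chart, acts on functions as a commutator.  By the chain
  rule, the two sides differ by an antisymmetrised second derivative of \<open>f\<close>.\<close>

lemma lie_bracket_commutator:
  assumes U: "open U" "p \<in> U" and X: "smooth_field_on M U X" and Z: "smooth_field_on M U Z"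
    and f: "smooth_fun_on M U f"
  shows "dir_deriv M f p (lie_bracket M X Z p) =
    field_app M X (field_app M Z f) p - field_app M Z (field_app M X f) p"
proof -
  define c where "c = chart_at M p"
  define S where "S = cmap c ` (U \<inter> cdom c)"
  define F where "F = f \<circ> cinv c"
  define x where "x = cmap c p"
  have c: "c \<in> atlas M" "p \<in> cdom c" unfolding c_def by (rule chart_at_in_atlas in_chart_at)+
  have S: "open S" "x \<in> S" unfolding S_def x_def using open_chart_image[OF c(1) U(1)] c U by auto
  have F: "smooth_on S F" unfolding S_def F_def using smooth_fun_onD[OF f c(1)] .
  have rep: "smooth_on S (field_rep M c W)" if "smooth_field_on M U W" for W
    unfolding S_def using smooth_field_onD[OF that c(1)] .
  have val: "field_rep M c W x = W p" for W
    unfolding field_rep_def x_def using c by (simp add: cinv_cmap c_def to_coord_chart_at)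
  have second: "field_app M V (field_app M W f) p =
      dir_deriv M f p (frechet_derivative (field_rep M c W) (at x) (field_rep M c V x)) +
      frechet_derivative (\<lambda>y. frechet_derivative F (at y) (W p)) (at x) (V p)"
    if W: "smooth_field_on M U W" for V W
  proof -
    have "field_app M V (field_app M W f) p =
        frechet_derivative (field_app M W f \<circ> cinv c) (at x) (V p)"
      unfolding field_app_def[of _ V] dir_deriv_def c_def x_def ..
    also have "frechet_derivative (field_app M W f \<circ> cinv c) (at x) =
        frechet_derivative (\<lambda>y. frechet_derivative F (at y) (field_rep M c W y)) (at x)"
      by (rule frechet_derivative_cong_open[OF S])
        (simp add: field_app_chart[OF f c(1)] S_def F_def)
    finally show ?thesis
      unfolding frechet_derivative_directional[OF F rep[OF W] S] val
      by (simp add: F_def dir_deriv_def c_def x_def)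
  qed
  have "lie_bracket M X Z p = frechet_derivative (field_rep M c Z) (at x) (field_rep M c X x) -
        frechet_derivative (field_rep M c X) (at x) (field_rep M c Z x)"
    unfolding lie_bracket_def Let_def c_def x_def ..
  then show ?thesis
    unfolding second[OF X] second[OF Z] linear_diff[OF linear_dir_deriv[OF f U(2)], symmetric]
    using second_derivative_symmetric[OF S(1) F S(2), of "X p" "Z p"]
    by (simp add: linear_diff[OF linear_dir_deriv[OF f U(2)]])
qed

section \<open>Coordinate fields\<close>

text \<open>Components in another chart arise from those in \<open>c\<close> by applying the differential of the transition
  map, which depends smoothly on the point.\<close>

lemma smooth_field_on_chartI:
  assumes c: "c \<in> atlas M" and U: "open U" "U \<subseteq> cdom c" and X: "smooth_on (cmap c ` U) (field_rep M c X)"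
  shows "smooth_field_on M U X"
  unfolding smooth_field_on_def
proof
  fix c' assume c': "c' \<in> atlas M"
  let ?S = "cmap c' ` (U \<inter> cdom c')" and ?T = "cmap c ` (cdom c' \<inter> cdom c)"
  let ?s = "cmap c \<circ> cinv c'" and ?t = "cmap c' \<circ> cinv c"
  have S: "open ?S" using open_chart_image[OF c' U(1)] .
  have s: "smooth_on ?S ?s"
    by (rule smooth_on_subset[OF smooth_transition_atlas[OF c' c]]) (use U in auto)
  let ?R = "\<lambda>x. frechet_derivative ?t (at x) (field_rep M c X x)"
  have openTU: "open (cmap c ` (cdom c' \<inter> U))"
    using open_chart_image[OF c, of "cdom c' \<inter> U"] U open_cdom[OF c']
    by (simp add: Int_assoc inf.absorb1 open_Int)
  have "smooth_on (cmap c ` (cdom c' \<inter> U)) ?R"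
    using U by (intro smooth_on_directional[OF openTU] smooth_on_subset[OF X]
        smooth_on_subset[OF smooth_transition_atlas[OF c c']]) auto
  then have "smooth_on ?S (?R \<circ> ?s)"
    using s S openTU by (intro smooth_on_compose[of ?S "cmap c ` (cdom c' \<inter> U)"]) (auto simp: cinv_cmap[OF c'])
  then show "smooth_on ?S (field_rep M c' X)"
  proof (rule smooth_on_cong[OF S, rotated])
    fix y assume "y \<in> ?S"
    then obtain q where q: "y = cmap c' q" "q \<in> U" "q \<in> cdom c'" by auto
    then show "(?R \<circ> ?s) y = field_rep M c' X y"
      using to_coord_change[OF c _ c', of q "X q"] U
      by (auto simp: field_rep_def cinv_cmap c c' subset_iff)
  qed
qed

lemma smooth_coord_field:
  assumes "c \<in> atlas M"
  shows "smooth_field_on M (cdom c) (\<lambda>q. of_coord M c q v)"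
  by (rule smooth_field_on_chartI[OF assms open_cdom[OF assms] order_refl])
    (rule smooth_on_cong[OF _ _ smooth_on_const[of _ v]],
      use open_chart_image[OF assms, of UNIV] in \<open>auto simp: field_rep_def cinv_cmap[OF assms] to_coord_of_coord[OF assms]\<close>)

lemma smooth_const_field: "smooth_field_on M (cdom (chart_at M p)) (const_field M p v)"
  using smooth_coord_field[OF chart_at_in_atlas, of p v] unfolding const_field_def by (simp add: eta_contract_eq)

lemma const_field_at: "const_field M p v p = v"
  unfolding const_field_def by (rule of_coord_chart_at)

section \<open>The metric\<close>

lemma bilinear_metric: "bilinear (gmetric M p)"
  and metric_sym: "gmetric M p v w = gmetric M p w v"
  and metric_pos: "v \<noteq> 0 \<Longrightarrow> gmetric M p v v > 0"
  using foliated_riemannian unfolding foliated_riemannian_manifold_def by blast+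

lemma metric_sum_left: "gmetric M p (\<Sum>i\<in>I. v i) w = (\<Sum>i\<in>I. gmetric M p (v i) w)"
  using bilinear_metric[of p] linear_sum[of "\<lambda>v. gmetric M p v w" v I] by (simp add: bilinear_def)

lemma metric_sum_right: "gmetric M p v (\<Sum>i\<in>I. w i) = (\<Sum>i\<in>I. gmetric M p v (w i))"
  using bilinear_metric[of p] by (simp add: bilinear_def linear_sum)

lemmas metric_simps = bilinear_ladd[OF bilinear_metric] bilinear_radd[OF bilinear_metric]
  bilinear_lsub[OF bilinear_metric] bilinear_rsub[OF bilinear_metric]
  bilinear_lmul[OF bilinear_metric] bilinear_rmul[OF bilinear_metric]
  bilinear_lneg[OF bilinear_metric] bilinear_rneg[OF bilinear_metric]
  bilinear_lzero[OF bilinear_metric] bilinear_rzero[OF bilinear_metric]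
  metric_sum_left metric_sum_right

text \<open>Smoothness of the metric is given on coordinate fields, in which \<open>X\<close> and \<open>Z\<close> are expanded.\<close>

lemma smooth_metric:
  assumes U: "open U" and X: "smooth_field_on M U X" and Z: "smooth_field_on M U Z"
  shows "smooth_fun_on M U (\<lambda>q. gmetric M q (X q) (Z q))"
  unfolding smooth_fun_on_def
proof
  fix c assume c: "c \<in> atlas M"
  let ?S = "cmap c ` (U \<inter> cdom c)"
  let ?g = "\<lambda>a b y. gmetric M (cinv c y) (of_coord M c (cinv c y) a) (of_coord M c (cinv c y) b)"
  have S: "open ?S" using open_chart_image[OF c U] .
  have "smooth_on (cmap c ` cdom c) (?g a b)" for a b
    using foliated_riemannian c unfolding foliated_riemannian_manifold_def by blast
  then have g: "smooth_on ?S (?g a b)" for a b by (rule smooth_on_subset) auto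
  have "smooth_on ?S (\<lambda>y. \<Sum>a\<in>Basis. \<Sum>b\<in>Basis.
      (field_rep M c X y \<bullet> a) * (field_rep M c Z y \<bullet> b) * ?g a b y)"
    using smooth_field_onD[OF X c] smooth_field_onD[OF Z c]
    by (intro smooth_on_sum smooth_on_mult smooth_on_inner smooth_on_const S g)
  then show "smooth_on ?S ((\<lambda>q. gmetric M q (X q) (Z q)) \<circ> cinv c)"
  proof (rule smooth_on_cong[OF S, rotated])
    fix y assume "y \<in> ?S"
    then obtain q where q: "y = cmap c q" "q \<in> U" "q \<in> cdom c" by auto
    have rep: "(\<Sum>a\<in>Basis. (to_coord M c q v \<bullet> a) *\<^sub>R of_coord M c q a) = v" for v
      using q of_coord_to_coord[OF c, of q v]
      by (simp add: linear_scale[OF linear_of_coord[OF c], symmetric]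
          linear_sum[OF linear_of_coord[OF c], symmetric] euclidean_representation)
    have "gmetric M q (X q) (Z q) = (\<Sum>a\<in>Basis. \<Sum>b\<in>Basis.
        (to_coord M c q (X q) \<bullet> a) * ((to_coord M c q (Z q) \<bullet> b) * gmetric M q (of_coord M c q a) (of_coord M c q b)))"
      by (subst rep[of "X q", symmetric], subst rep[of "Z q", symmetric], unfold metric_sum_left)
        (simp only: metric_simps sum_distrib_left real_scaleR_def mult.left_commute)
    then show "(\<Sum>a\<in>Basis. \<Sum>b\<in>Basis. (field_rep M c X y \<bullet> a) * (field_rep M c Z y \<bullet> b) * ?g a b y) =
        ((\<lambda>q. gmetric M q (X q) (Z q)) \<circ> cinv c) y"
      using q c by (simp add: field_rep_def cinv_cmap mult.assoc)
  qed
qed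

section \<open>The vertical bundle\<close>

lemma leafdirs_Basis: "leafdirs M \<subseteq> Basis" "finite (leafdirs M)"
  using foliated_riemannian finite_subset[OF _ finite_Basis, of "leafdirs M"]
  unfolding foliated_riemannian_manifold_def by auto

lemma span_leafdirs: "v \<in> span (leafdirs M) \<longleftrightarrow> (\<forall>b \<in> Basis - leafdirs M. v \<bullet> b = 0)"
  using span_substd_basis[OF leafdirs_Basis(1)] by auto

text \<open>A transition map preserves plaques, so its differential preserves the tangent spaces of the
  plaques, and verticality may be tested in a single chart.\<close>

lemma transition_preserves_leafdirs:
  assumes c: "c \<in> atlas M" "p \<in> cdom c" and c': "c' \<in> atlas M" "p \<in> cdom c'"
    and v: "v \<in> span (leafdirs M)"
  shows "frechet_derivative (cmap c' \<circ> cinv c) (at (cmap c p)) v \<in> span (leafdirs M)"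
  unfolding span_leafdirs
proof
  fix b assume b: "b \<in> Basis - leafdirs M"
  let ?t = "cmap c' \<circ> cinv c" and ?x = "cmap c p"
  have "?x \<in> cmap c ` (cdom c \<inter> cdom c')" using c c' by auto
  moreover have "foliated_transition (leafdirs M) c c'"
    using foliated_riemannian c c' unfolding foliated_riemannian_manifold_def by blast
  ultimately have "\<exists>W. open W \<and> ?x \<in> W \<and> W \<subseteq> cmap c ` (cdom c \<inter> cdom c') \<and>
      (\<forall>y\<in>W. \<forall>z\<in>W. (\<forall>b \<in> Basis - leafdirs M. y \<bullet> b = z \<bullet> b) \<longrightarrow>
        (\<forall>b \<in> Basis - leafdirs M. cmap c' (cinv c y) \<bullet> b = cmap c' (cinv c z) \<bullet> b))"
    unfolding foliated_transition_def by (rule bspec[rotated])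
  then obtain W where W: "open W" "?x \<in> W"
    and const: "\<forall>y\<in>W. \<forall>z\<in>W. (\<forall>b \<in> Basis - leafdirs M. y \<bullet> b = z \<bullet> b) \<longrightarrow>
        (\<forall>b \<in> Basis - leafdirs M. cmap c' (cinv c y) \<bullet> b = cmap c' (cinv c z) \<bullet> b)"
    by (elim exE conjE)
  let ?l = "\<lambda>s::real. ?x + s *\<^sub>R v"
  have l: "(?l has_derivative (\<lambda>s. s *\<^sub>R v)) (at 0)" by (auto intro!: derivative_eq_intros)
  have t: "(?t has_derivative frechet_derivative ?t (at ?x)) (at (?l 0))"
    using transition_differentiable[OF c c'] unfolding frechet_derivative_works by simp
  have "((\<lambda>s. (?t \<circ> ?l) s \<bullet> b) has_derivative (\<lambda>s. (frechet_derivative ?t (at ?x) \<circ> (\<lambda>s. s *\<^sub>R v)) s \<bullet> b)) (at 0)"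
    using diff_chain_at[OF l t] by (rule has_derivative_inner_left)
  moreover have "((\<lambda>s. (?t \<circ> ?l) s \<bullet> b) has_derivative (\<lambda>s. 0)) (at 0)"
  proof (rule has_derivative_transform_within_open[OF has_derivative_const])
    have "continuous_on UNIV ?l" by (intro continuous_intros)
    then show "open (?l -` W)" using W(1) by (simp add: continuous_on_open_vimage[OF open_UNIV])
    show "0 \<in> ?l -` W" using W(2) by simp
    show "?t ?x \<bullet> b = (?t \<circ> ?l) s \<bullet> b" if "s \<in> ?l -` W" for s
    proof -
      have "\<forall>b \<in> Basis - leafdirs M. ?x \<bullet> b = ?l s \<bullet> b"
        using v by (simp add: span_leafdirs inner_add_left)
      then show ?thesis using const[rule_format, OF W(2), of "?l s" b] that b by simp
    qed
  qed
  ultimately have "(\<lambda>s. (frechet_derivative ?t (at ?x) \<circ> (\<lambda>s. s *\<^sub>R v)) s \<bullet> b) = (\<lambda>s. 0)"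
    by (rule has_derivative_unique)
  from fun_cong[OF this, of 1] show "frechet_derivative ?t (at ?x) v \<bullet> b = 0" by simp
qed

lemma vertical_iff:
  assumes "c \<in> atlas M" "p \<in> cdom c"
  shows "v \<in> vertical M p \<longleftrightarrow> to_coord M c p v \<in> span (leafdirs M)"
proof
  show "v \<in> vertical M p \<Longrightarrow> to_coord M c p v \<in> span (leafdirs M)"
    unfolding vertical_def using assms by blast
  assume "to_coord M c p v \<in> span (leafdirs M)"
  then have "to_coord M c' p v \<in> span (leafdirs M)" if "c' \<in> atlas M" "p \<in> cdom c'" for c'
    unfolding to_coord_change[OF assms that] by (rule transition_preserves_leafdirs[OF assms that])
  then show "v \<in> vertical M p" unfolding vertical_def by blast
qed

lemma subspace_vertical: "subspace (vertical M p)"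
proof -
  have "vertical M p = to_coord M (chart_at M p) p -` span (leafdirs M)"
    using vertical_iff[OF chart_at_in_atlas in_chart_at] by blast
  then show ?thesis
    using linear_subspace_vimage[OF linear_to_coord[OF chart_at_in_atlas in_chart_at] subspace_span]
    by simp
qed

text \<open>In a foliated chart the components of vertical fields lie in a fixed linear subspace, and so do
  their derivatives.\<close>

lemma lie_bracket_vertical:
  assumes U: "open U" "p \<in> U" and X: "smooth_field_on M U X" "vertical_on M U X"
    and Z: "smooth_field_on M U Z" "vertical_on M U Z"
  shows "lie_bracket M X Z p \<in> vertical M p"
proof -
  let ?c = "chart_at M p"
  let ?x = "cmap ?c p" and ?S = "cmap ?c ` (U \<inter> cdom ?c)"
  have S: "open ?S" "?x \<in> ?S"
    using open_chart_image[OF chart_at_in_atlas U(1)] U in_chart_at by auto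
  have der: "frechet_derivative (field_rep M ?c W) (at ?x) v \<in> span (leafdirs M)"
    if W: "smooth_field_on M U W" "vertical_on M U W" for W v
    unfolding span_leafdirs
  proof
    fix b assume b: "b \<in> Basis - leafdirs M"
    have zero: "field_rep M ?c W y \<bullet> b = 0" if "y \<in> ?S" for y
      using that W(2) b vertical_iff[OF chart_at_in_atlas, of _ p]
      by (auto simp: field_rep_def cinv_cmap chart_at_in_atlas vertical_on_def span_leafdirs)
    have "((\<lambda>y. field_rep M ?c W y \<bullet> b) has_derivative
        (\<lambda>v. frechet_derivative (field_rep M ?c W) (at ?x) v \<bullet> b)) (at ?x)"
      using smooth_on_differentiable[OF smooth_field_onD[OF W(1) chart_at_in_atlas] S(2)]
      unfolding frechet_derivative_works by (rule has_derivative_inner_left)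
    moreover have "((\<lambda>y. field_rep M ?c W y \<bullet> b) has_derivative (\<lambda>v. 0)) (at ?x)"
      by (rule has_derivative_transform_within_open[OF has_derivative_const S]) (simp add: zero)
    ultimately have "(\<lambda>v. frechet_derivative (field_rep M ?c W) (at ?x) v \<bullet> b) = (\<lambda>v. 0)"
      by (rule has_derivative_unique)
    then show "frechet_derivative (field_rep M ?c W) (at ?x) v \<bullet> b = 0" by metis
  qed
  show ?thesis
    unfolding vertical_iff[OF chart_at_in_atlas in_chart_at] to_coord_chart_at lie_bracket_def Let_def
    by (intro span_diff der X Z)
qed

section \<open>Orthonormal and adapted frames\<close>

definition orthonormal_at :: "'a \<Rightarrow> 'e set \<Rightarrow> ('e \<Rightarrow> 'e) \<Rightarrow> bool" where
  "orthonormal_at p A e \<longleftrightarrow> (\<forall>a\<in>A. \<forall>b\<in>A. gmetric M p (e a) (e b) = (if a = b then 1 else 0))"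

lemma metric_orthonormal_sum:
  assumes "orthonormal_at p A e" "A \<subseteq> Basis" "b \<in> A"
  shows "gmetric M p (\<Sum>a\<in>A. x a *\<^sub>R e a) (e b) = x b"
proof -
  have "gmetric M p (\<Sum>a\<in>A. x a *\<^sub>R e a) (e b) = (\<Sum>a\<in>A. x a * (if a = b then 1 else 0))"
    using assms unfolding metric_simps orthonormal_at_def by (intro sum.cong) auto
  also have "\<dots> = x b" using assms(3) finite_subset[OF assms(2) finite_Basis]
    by (simp add: if_distrib[of "\<lambda>t. _ * t"] sum.delta cong: if_cong)
  finally show ?thesis .
qed

text \<open>The linear map sending \<open>Basis\<close> to an orthonormal family is injective, hence surjective.\<close>

lemma orthonormal_expand:
  assumes e: "orthonormal_at p Basis e"
  shows "(\<Sum>b\<in>Basis. gmetric M p v (e b) *\<^sub>R e b) = v"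
proof -
  define T where "T w = (\<Sum>b\<in>Basis. (w \<bullet> b) *\<^sub>R e b)" for w :: 'e
  have comp: "gmetric M p (T w) (e b) = w \<bullet> b" if "b \<in> Basis" for w b
    unfolding T_def by (rule metric_orthonormal_sum[OF e order_refl that])
  have lin: "linear T" unfolding T_def
    by (intro linear_compose_sum ballI linearI) (simp_all add: inner_add_left scaleR_add_left)
  have "inj T"
    unfolding linear_injective_0[OF lin]
  proof (intro allI impI)
    fix w assume w: "T w = 0"
    have "w \<bullet> b = 0" if "b \<in> Basis" for b
      using comp[OF that, of w] w by (simp add: bilinear_lzero[OF bilinear_metric])
    then show "w = 0" by (metis euclidean_all_zero_iff)
  qed
  then have "surj T" using linear_injective_imp_surjective[OF lin] by blast
  then obtain w where "v = T w" by (metis surjD)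
  then show ?thesis using comp by (simp add: T_def)
qed

lemma parseval:
  assumes e: "orthonormal_at p Basis e"
  shows "(\<Sum>b\<in>Basis. gmetric M p u (e b) * gmetric M p w (e b)) = gmetric M p u w"
proof -
  have "gmetric M p u w = gmetric M p u (\<Sum>b\<in>Basis. gmetric M p w (e b) *\<^sub>R e b)"
    by (simp only: orthonormal_expand[OF e])
  then show ?thesis by (simp add: metric_simps mult.commute)
qed

text \<open>Subtracting the projection and normalising; the difference vanishes nowhere because \<open>E\<close> is
  pointwise independent of the given fields.\<close>

lemma gram_schmidt_step:
  assumes U: "open U" and A: "finite A" "A \<subseteq> Basis"
    and F': "\<forall>a\<in>A. smooth_field_on M U (F a)" "\<forall>q\<in>U. orthonormal_at q A (\<lambda>a. F a q)"
    and E': "smooth_field_on M U E" "\<forall>q\<in>U. E q \<notin> span ((\<lambda>a. F a q) ` A)"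
  shows "\<exists>N. smooth_field_on M U N \<and> (\<forall>q\<in>U. gmetric M q (N q) (N q) = 1 \<and>
    (\<forall>a\<in>A. gmetric M q (N q) (F a q) = 0) \<and>
    span (insert (N q) ((\<lambda>a. F a q) ` A)) = span (insert (E q) ((\<lambda>a. F a q) ` A)))"
proof -
  note F = bspec[OF F'(1)] bspec[OF F'(2)] and E = E'(1) bspec[OF E'(2)]
  define s where "s q = (\<Sum>a\<in>A. gmetric M q (E q) (F a q) *\<^sub>R F a q)" for q
  define W where "W q = E q - s q" for q
  \<comment> \<open>a power instead of the inverse of a square root, since powers are known to be smooth\<close>
  define r where "r q = gmetric M q (W q) (W q) powr (-1/2)" for q
  define N where "N q = r q *\<^sub>R W q" for q
  have s: "s q \<in> span ((\<lambda>a. F a q) ` A)" for q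
    unfolding s_def by (intro span_sum span_scale span_base) auto
  have "W q \<noteq> 0" if "q \<in> U" for q using s[of q] E(2)[OF that] unfolding W_def by auto
  then have pos: "gmetric M q (W q) (W q) > 0" if "q \<in> U" for q using metric_pos that by auto
  have W: "smooth_field_on M U W" unfolding W_def s_def
    by (intro smooth_field_diff smooth_field_sum smooth_field_scale smooth_metric U F E)
  show ?thesis
  proof (intro exI[of _ N] conjI ballI)
    show "smooth_field_on M U N" unfolding N_def r_def
      by (intro smooth_field_scale smooth_fun_powr smooth_metric U W pos)
    fix q assume q: "q \<in> U"
    have "r q * r q * gmetric M q (W q) (W q) = gmetric M q (W q) (W q) powr (-1/2 + -1/2) * gmetric M q (W q) (W q) powr 1"
      using pos[OF q] unfolding r_def powr_add by simp
    also have "\<dots> = 1" using pos[OF q] unfolding powr_add[symmetric] by simp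
    finally show "gmetric M q (N q) (N q) = 1" unfolding N_def by (simp add: metric_simps mult.assoc)
    show "gmetric M q (N q) (F a q) = 0" if "a \<in> A" for a
      using metric_orthonormal_sum[OF F(2)[OF q] A(2) that, of "\<lambda>a. gmetric M q (E q) (F a q)"]
      unfolding N_def W_def s_def by (simp add: metric_simps del: metric_sum_left)
    have "r q \<noteq> 0" using pos[OF q] unfolding r_def by simp
    then have "E q = (1 / r q) *\<^sub>R N q + s q" unfolding N_def W_def by simp
    then have "E q \<in> span (insert (N q) ((\<lambda>a. F a q) ` A))"
      using s[of q] span_mono[of "(\<lambda>a. F a q) ` A" "insert (N q) ((\<lambda>a. F a q) ` A)"]
      by (metis insertI1 span_add span_base span_scale subsetD subset_insertI)
    moreover have "N q \<in> span (insert (E q) ((\<lambda>a. F a q) ` A))"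
      using s[of q] span_mono[of "(\<lambda>a. F a q) ` A" "insert (E q) ((\<lambda>a. F a q) ` A)"] unfolding N_def W_def
      by (intro span_scale span_diff) (auto intro: span_base)
    ultimately show "span (insert (N q) ((\<lambda>a. F a q) ` A)) = span (insert (E q) ((\<lambda>a. F a q) ` A))"
      unfolding span_eq by (auto intro: span_base)
  qed
qed

lemma coord_fields_independent:
  assumes c: "c \<in> atlas M" "q \<in> cdom c" and A: "A \<subseteq> Basis" "b \<in> Basis" "b \<notin> A"
  shows "of_coord M c q b \<notin> span (of_coord M c q ` A)"
proof
  assume "of_coord M c q b \<in> span (of_coord M c q ` A)"
  then have "to_coord M c q (of_coord M c q b) \<in> to_coord M c q ` span (of_coord M c q ` A)" by blast
  also have "\<dots> = span (to_coord M c q ` of_coord M c q ` A)"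
    by (rule linear_span_image[OF linear_to_coord[OF c], symmetric])
  also have "to_coord M c q ` of_coord M c q ` A = A"
    by (simp add: image_image to_coord_of_coord[OF c])
  finally have "b \<in> span A" by (simp add: to_coord_of_coord[OF c])
  then show False using span_substd_basis[OF A(1)] A by auto
qed

text \<open>The fields already orthonormal are kept, and spans are preserved.  Both matter for adapted frames:
  the vertical part is built first, and must go on spanning the vertical bundle.\<close>

lemma gram_schmidt_chart:
  assumes c: "c \<in> atlas M" and B: "finite B" "A \<subseteq> Basis" "B \<subseteq> Basis" "A \<inter> B = {}"
    and F: "\<And>a. a \<in> A \<Longrightarrow> smooth_field_on M (cdom c) (F a)"
      "\<And>q. q \<in> cdom c \<Longrightarrow> orthonormal_at q A (\<lambda>a. F a q)"
      "\<And>q. q \<in> cdom c \<Longrightarrow> span ((\<lambda>a. F a q) ` A) = span (of_coord M c q ` A)"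
  shows "\<exists>F'. (\<forall>a\<in>A. F' a = F a) \<and> (\<forall>a\<in>A \<union> B. smooth_field_on M (cdom c) (F' a)) \<and>
      (\<forall>q\<in>cdom c. orthonormal_at q (A \<union> B) (\<lambda>a. F' a q) \<and>
        span ((\<lambda>a. F' a q) ` (A \<union> B)) = span (of_coord M c q ` (A \<union> B)))"
  using B
proof (induction B rule: finite_induct)
  case empty
  show ?case using F by (intro exI[of _ F]) simp
next
  case (insert b B)
  let ?A = "A \<union> B"
  obtain G where G: "\<forall>a\<in>A. G a = F a" "\<forall>a\<in>?A. smooth_field_on M (cdom c) (G a)"
      "\<forall>q\<in>cdom c. orthonormal_at q ?A (\<lambda>a. G a q) \<and>
        span ((\<lambda>a. G a q) ` ?A) = span (of_coord M c q ` ?A)"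
    using insert by auto
  have A: "?A \<subseteq> Basis" "finite ?A" "b \<in> Basis" "b \<notin> ?A"
    using insert finite_subset[OF _ finite_Basis, of A] by auto
  have Go: "\<forall>q\<in>cdom c. orthonormal_at q ?A (\<lambda>a. G a q)" using G(3) by blast
  have Gn: "\<forall>q\<in>cdom c. of_coord M c q b \<notin> span ((\<lambda>a. G a q) ` ?A)"
    using G(3) coord_fields_independent[OF c _ A(1,3,4)] by simp
  obtain N where N: "smooth_field_on M (cdom c) N"
    "\<forall>q\<in>cdom c. gmetric M q (N q) (N q) = 1 \<and> (\<forall>a\<in>?A. gmetric M q (N q) (G a q) = 0) \<and>
      span (insert (N q) ((\<lambda>a. G a q) ` ?A)) = span (insert (of_coord M c q b) ((\<lambda>a. G a q) ` ?A))"
    using gram_schmidt_step[OF open_cdom[OF c] A(2,1) G(2) Go smooth_coord_field[OF c, of b] Gn]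
    by (elim exE conjE)
  have img: "(\<lambda>a. (G(b := N)) a q) ` (A \<union> insert b B) = insert (N q) ((\<lambda>a. G a q) ` ?A)" for q
    using A(4) by auto
  have sp: "span (insert (of_coord M c q b) ((\<lambda>a. G a q) ` ?A)) = span (of_coord M c q ` (A \<union> insert b B))"
    if "q \<in> cdom c" for q
    using G(3) that by (simp add: span_insert[of _ "(\<lambda>a. G a q) ` ?A"] span_insert[of _ "of_coord M c q ` ?A"])
  have orth: "orthonormal_at q (A \<union> insert b B) (\<lambda>a. (G(b := N)) a q)" if q: "q \<in> cdom c" for q
  proof -
    have "gmetric M q (N q) (G a q) = 0" "gmetric M q (G a q) (N q) = 0" if "a \<in> ?A" for a
      using N(2) q that metric_sym[of q "G a q" "N q"] by auto
    then show ?thesis using G(3) q N(2) A(4) unfolding orthonormal_at_def by auto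
  qed
  show ?case
  proof (intro exI[of _ "G(b := N)"] conjI ballI)
    show "(G(b := N)) a = F a" if "a \<in> A" for a using G(1) A(4) that by auto
    show "smooth_field_on M (cdom c) ((G(b := N)) a)" if "a \<in> A \<union> insert b B" for a
      using G(2) N(1) that by auto
    show "span ((\<lambda>a. (G(b := N)) a q) ` (A \<union> insert b B)) = span (of_coord M c q ` (A \<union> insert b B))"
      if "q \<in> cdom c" for q unfolding img using N(2) sp that by simp
  qed (rule orth)
qed

lemma coord_span_vertical:
  assumes "c \<in> atlas M" "q \<in> cdom c"
  shows "span (of_coord M c q ` leafdirs M) = vertical M q"
proof -
  have "span (of_coord M c q ` leafdirs M) = of_coord M c q ` span (leafdirs M)"
    by (rule linear_span_image[OF linear_of_coord[OF assms]])
  also have "\<dots> = vertical M q"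
  proof (intro equalityI subsetI)
    fix v assume "v \<in> vertical M q"
    then show "v \<in> of_coord M c q ` span (leafdirs M)"
      using vertical_iff[OF assms] of_coord_to_coord[OF assms, of v] by (metis image_eqI)
  qed (use vertical_iff[OF assms] to_coord_of_coord[OF assms] in auto)
  finally show ?thesis .
qed

text \<open>Orthonormalising the coordinate fields with the leaf directions first yields an adapted frame,
  because the leaf directions span the vertical bundle.\<close>

lemma adapted_frame_exists: "\<exists>F. adapted_frame M (cdom (chart_at M p)) F"
proof -
  let ?c = "chart_at M p"
  note c = chart_at_in_atlas[of p]
  obtain F where F: "\<forall>a\<in>leafdirs M. smooth_field_on M (cdom ?c) (F a)"
      "\<forall>q\<in>cdom ?c. orthonormal_at q (leafdirs M) (\<lambda>a. F a q) \<and>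
        span ((\<lambda>a. F a q) ` leafdirs M) = span (of_coord M ?c q ` leafdirs M)"
    using gram_schmidt_chart[OF c leafdirs_Basis(2), of "{}" "\<lambda>_ _. 0"] leafdirs_Basis(1)
    by (auto simp: orthonormal_at_def)
  have "\<exists>G. (\<forall>a\<in>leafdirs M. G a = F a) \<and>
      (\<forall>a\<in>leafdirs M \<union> (Basis - leafdirs M). smooth_field_on M (cdom ?c) (G a)) \<and>
      (\<forall>q\<in>cdom ?c. orthonormal_at q (leafdirs M \<union> (Basis - leafdirs M)) (\<lambda>a. G a q) \<and>
        span ((\<lambda>a. G a q) ` (leafdirs M \<union> (Basis - leafdirs M))) =
        span (of_coord M ?c q ` (leafdirs M \<union> (Basis - leafdirs M))))"
    by (rule gram_schmidt_chart[OF c]) (use F leafdirs_Basis in auto)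
  moreover have "leafdirs M \<union> (Basis - leafdirs M) = Basis" using leafdirs_Basis by auto
  ultimately obtain G where G: "\<forall>a\<in>leafdirs M. G a = F a"
      "\<forall>a\<in>Basis. smooth_field_on M (cdom ?c) (G a)"
      "\<forall>q\<in>cdom ?c. orthonormal_at q Basis (\<lambda>a. G a q)" by auto
  have sp: "span ((\<lambda>a. G a q) ` leafdirs M) = vertical M q" if "q \<in> cdom ?c" for q
    using F(2) G(1) that coord_span_vertical[OF c that] by auto
  have vert: "G b q \<in> vertical M q" if "q \<in> cdom ?c" "b \<in> leafdirs M" for b q
    using sp[OF that(1), symmetric] that(2) by (auto intro: span_base)
  have hor: "G b q \<in> horizontal M q" if q: "q \<in> cdom ?c" and b: "b \<in> Basis - leafdirs M" for b q
    unfolding horizontal_def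
  proof (intro CollectI ballI)
    fix w assume "w \<in> vertical M q"
    then have "w \<in> span ((\<lambda>a. G a q) ` leafdirs M)" using sp[OF q] by simp
    then show "gmetric M q (G b q) w = 0"
    proof (induction rule: span_induct)
      case base
      show ?case unfolding subspace_def by (simp add: metric_simps)
    next
      case (step w)
      then show ?case using G(3) q b leafdirs_Basis(1) unfolding orthonormal_at_def by auto
    qed
  qed
  show ?thesis
    unfolding adapted_frame_def using G open_cdom[OF c] vert hor
    by (intro exI[of _ G]) (auto simp: orthonormal_at_def vertical_on_def horizontal_on_def)
qed

lemma adapted_frameD:
  assumes "adapted_frame M U F"
  shows "open U"
    and "b \<in> Basis \<Longrightarrow> smooth_field_on M U (F b)"
    and "p \<in> U \<Longrightarrow> orthonormal_at p Basis (\<lambda>b. F b p)"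
    and "b \<in> leafdirs M \<Longrightarrow> vertical_on M U (F b)"
    and "p \<in> U \<Longrightarrow> b \<in> leafdirs M \<Longrightarrow> F b p \<in> vertical M p"
    and "p \<in> U \<Longrightarrow> b \<in> Basis - leafdirs M \<Longrightarrow> F b p \<in> horizontal M p"
  using assms unfolding adapted_frame_def orthonormal_at_def vertical_on_def horizontal_on_def by blast+

lemma adapted_frame_subset: "adapted_frame M U F \<Longrightarrow> open W \<Longrightarrow> W \<subseteq> U \<Longrightarrow> adapted_frame M W F"
  unfolding adapted_frame_def vertical_on_def horizontal_on_def by (meson smooth_field_subset subsetD)

lemma smooth_leaf_frame: "adapted_frame M U F \<Longrightarrow> a \<in> leafdirs M \<Longrightarrow> smooth_field_on M U (F a)"
  using adapted_frameD(2) leafdirs_Basis(1) by blast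

lemma horizontal_vertical: "v \<in> horizontal M p \<Longrightarrow> w \<in> vertical M p \<Longrightarrow> gmetric M p v w = 0"
  "v \<in> horizontal M p \<Longrightarrow> w \<in> vertical M p \<Longrightarrow> gmetric M p w v = 0"
  unfolding horizontal_def by (auto simp: metric_sym[of p w])

text \<open>Horizontal components of \<open>v\<close> vanish by orthogonality, so adapted frames restrict to bases of the
  vertical space without counting dimensions.\<close>

lemma vertical_expand:
  assumes F: "adapted_frame M U F" "p \<in> U" and v: "v \<in> vertical M p"
  shows "(\<Sum>a\<in>leafdirs M. gmetric M p v (F a p) *\<^sub>R F a p) = v"
proof -
  have "(\<Sum>a\<in>leafdirs M. gmetric M p v (F a p) *\<^sub>R F a p) = (\<Sum>a\<in>Basis. gmetric M p v (F a p) *\<^sub>R F a p)"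
    using horizontal_vertical(2)[OF adapted_frameD(6)[OF F] v] leafdirs_Basis(1)
    by (intro sum.mono_neutral_left) auto
  then show ?thesis using orthonormal_expand[OF adapted_frameD(3)[OF F]] by simp
qed

lemma vertical_parseval:
  assumes F: "adapted_frame M U F" "p \<in> U" and v: "v \<in> vertical M p"
  shows "(\<Sum>a\<in>leafdirs M. gmetric M p v (F a p) * gmetric M p w (F a p)) = gmetric M p v w"
proof -
  have "gmetric M p v w = gmetric M p (\<Sum>a\<in>leafdirs M. gmetric M p v (F a p) *\<^sub>R F a p) w"
    by (simp only: vertical_expand[OF assms])
  then show ?thesis by (simp add: metric_simps metric_sym[of p w])
qed

lemma vertical_frame_eqI:
  assumes F: "adapted_frame M U F" "p \<in> U" and v: "v \<in> vertical M p" "w \<in> vertical M p"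
    and eq: "\<And>a. a \<in> leafdirs M \<Longrightarrow> gmetric M p v (F a p) = gmetric M p w (F a p)"
  shows "v = w"
proof -
  have "(\<Sum>a\<in>leafdirs M. gmetric M p v (F a p) *\<^sub>R F a p) = (\<Sum>a\<in>leafdirs M. gmetric M p w (F a p) *\<^sub>R F a p)"
    using eq by simp
  then show ?thesis unfolding vertical_expand[OF F v(1)] vertical_expand[OF F v(2)] .
qed

lemma vertical_eqI:
  assumes "v \<in> vertical M p" "w \<in> vertical M p" "\<And>u. u \<in> vertical M p \<Longrightarrow> gmetric M p v u = gmetric M p w u"
  shows "v = w"
proof -
  have "v - w \<in> vertical M p" using assms subspace_diff[OF subspace_vertical] by blast
  then have "gmetric M p (v - w) (v - w) = 0" using assms(3)[of "v - w"] by (simp add: metric_simps)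
  then have "v - w = 0" using metric_pos[of "v - w" p] by (metis less_irrefl)
  then show ?thesis by simp
qed

section \<open>Projections and gradients\<close>

lemma vproj_frame:
  assumes F: "adapted_frame M U F" "p \<in> U"
  shows "vproj M p v = (\<Sum>a\<in>leafdirs M. gmetric M p v (F a p) *\<^sub>R F a p)" (is "_ = ?w")
    and "vproj M p v \<in> vertical M p" and "v - vproj M p v \<in> horizontal M p"
proof -
  have w: "?w \<in> vertical M p"
    by (intro subspace_sum subspace_scale subspace_vertical adapted_frameD(5)[OF F])
  have on: "orthonormal_at p (leafdirs M) (\<lambda>a. F a p)"
    using adapted_frameD(3)[OF F] leafdirs_Basis(1) unfolding orthonormal_at_def by blast
  have "gmetric M p ?w u = gmetric M p v u" if u: "u \<in> vertical M p" for u
    using vertical_parseval[OF F w, of u] vertical_parseval[OF F u, of v]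
    by (simp add: metric_orthonormal_sum[OF on leafdirs_Basis(1)] metric_sym[of p u] mult.commute)
  then have h: "v - ?w \<in> horizontal M p" unfolding horizontal_def by (simp add: metric_simps)
  show *: "vproj M p v = ?w"
    unfolding vproj_def
  proof (rule the_equality)
    show "?w \<in> vertical M p \<and> v - ?w \<in> horizontal M p" using w h by blast
    fix x assume x: "x \<in> vertical M p \<and> v - x \<in> horizontal M p"
    show "x = ?w"
    proof (rule vertical_eqI)
      fix u assume "u \<in> vertical M p"
      then have "gmetric M p (v - x) u = 0" "gmetric M p (v - ?w) u = 0"
        using x h horizontal_vertical by blast+
      then show "gmetric M p x u = gmetric M p ?w u" by (simp add: metric_simps)
    qed (use x w in auto)
  qed
  show "vproj M p v \<in> vertical M p" "v - vproj M p v \<in> horizontal M p"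
    unfolding * by (rule w h)+
qed

lemma frame_at:
  obtains U F where "adapted_frame M U F" "p \<in> U"
  using adapted_frame_exists in_chart_at by blast

lemma vproj_vertical: "vproj M p v \<in> vertical M p"
  by (rule frame_at[of p]) (rule vproj_frame(2))

lemma metric_vproj:
  assumes "u \<in> vertical M p"
  shows "gmetric M p (vproj M p v) u = gmetric M p v u"
proof -
  obtain U F where "adapted_frame M U F" "p \<in> U" using frame_at .
  from horizontal_vertical(1)[OF vproj_frame(3)[OF this] assms, of v]
  show ?thesis by (simp add: metric_simps)
qed

lemma vproj_of_vertical: "v \<in> vertical M p \<Longrightarrow> vproj M p v = v"
  by (rule vertical_eqI[OF vproj_vertical _ metric_vproj])

lemma vproj_diff: "vproj M p (v - w) = vproj M p v - vproj M p w"
  by (rule vertical_eqI[where p = p])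
    (auto simp: metric_vproj metric_simps vproj_vertical subspace_diff[OF subspace_vertical])

text \<open>Riesz representation: an orthonormal frame provides the representing vector, and positivity of the
  metric makes it unique.\<close>

lemma metric_grad:
  assumes f: "smooth_fun_on M U f" "p \<in> U"
  shows "gmetric M p (grad M f p) v = dir_deriv M f p v"
proof -
  obtain W F where F: "adapted_frame M W F" "p \<in> W" using frame_at[of p] .
  note on = adapted_frameD(3)[OF F]
  let ?v = "\<Sum>b\<in>Basis. dir_deriv M f p (F b p) *\<^sub>R F b p"
  have ex: "\<forall>w. gmetric M p ?v w = dir_deriv M f p w"
  proof
    fix w
    have "dir_deriv M f p w = dir_deriv M f p (\<Sum>b\<in>Basis. gmetric M p w (F b p) *\<^sub>R F b p)"
      by (simp only: orthonormal_expand[OF on])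
    also have "\<dots> = (\<Sum>b\<in>Basis. gmetric M p w (F b p) * dir_deriv M f p (F b p))"
      using linear_dir_deriv[OF f] by (simp add: linear_sum linear_scale)
    also have "\<dots> = gmetric M p ?v w" by (simp add: metric_simps metric_sym[of p w] mult.commute)
    finally show "gmetric M p ?v w = dir_deriv M f p w" by simp
  qed
  have "grad M f p = ?v"
    unfolding grad_def
  proof (rule the_equality)
    show "\<forall>w. gmetric M p ?v w = dir_deriv M f p w" by (rule ex)
    fix x assume "\<forall>w. gmetric M p x w = dir_deriv M f p w"
    then have "gmetric M p (x - ?v) (x - ?v) = 0"
      unfolding bilinear_lsub[OF bilinear_metric, of p x] using ex by simp
    then have "x - ?v = 0" using metric_pos[of "x - ?v" p] by (metis less_irrefl)
    then show "x = ?v" by simp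
  qed
  then show ?thesis using ex by simp
qed

lemma vgrad_vertical: "vgrad M f p \<in> vertical M p"
  unfolding vgrad_def by (rule vproj_vertical)

lemma vertical_on_vgrad: "vertical_on M W (vgrad M f)"
  unfolding vertical_on_def using vgrad_vertical by blast

lemma metric_vgrad:
  assumes "smooth_fun_on M U f" "p \<in> U" "v \<in> vertical M p"
  shows "gmetric M p (vgrad M f p) v = dir_deriv M f p v"
  unfolding vgrad_def metric_vproj[OF assms(3)] by (rule metric_grad[OF assms(1,2)])

lemma smooth_vgrad:
  assumes F: "adapted_frame M U F" and f: "smooth_fun_on M U f"
  shows "smooth_field_on M U (vgrad M f)"
proof (rule smooth_field_cong[OF adapted_frameD(1)[OF F]])
  show "smooth_field_on M U (\<lambda>q. \<Sum>a\<in>leafdirs M. field_app M (F a) f q *\<^sub>R F a q)"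
    by (intro smooth_field_sum smooth_field_scale smooth_field_app smooth_leaf_frame[OF F]
        adapted_frameD(1)[OF F] f)
  show "(\<Sum>a\<in>leafdirs M. field_app M (F a) f q *\<^sub>R F a q) = vgrad M f q" if q: "q \<in> U" for q
    using vertical_expand[OF F q vgrad_vertical[of f q]]
    by (simp add: metric_vgrad[OF f q adapted_frameD(5)[OF F q]] field_app_def)
qed

section \<open>Connections\<close>

lemma connection_smooth:
  assumes "is_connection M C" "open U" "smooth_field_on M U X" "smooth_field_on M U Z"
  shows "smooth_field_on M U (C X Z)"
  using assms smooth_fun_const unfolding is_connection_def by blast

lemma connection_cong:
  assumes "is_connection M C" "open U" "smooth_field_on M U X" "smooth_field_on M U Z"
    and "\<And>q. q \<in> U \<Longrightarrow> X q = X' q" "\<And>q. q \<in> U \<Longrightarrow> Z q = Z' q" "p \<in> U"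
  shows "C X Z p = C X' Z' p"
proof -
  have "smooth_field_on M U X'" "smooth_field_on M U Z'"
    using smooth_field_cong[OF assms(2)] assms by blast+
  then show ?thesis
    using assms smooth_fun_const[of U 0] unfolding is_connection_def by blast
qed

lemma connection_left:
  assumes "is_connection M C" "open U" "smooth_field_on M U X" "smooth_field_on M U X'"
    "smooth_field_on M U Z" "smooth_fun_on M U f" "p \<in> U"
  shows "C (\<lambda>q. f q *\<^sub>R X q + X' q) Z p = f p *\<^sub>R C X Z p + C X' Z p"
  using assms unfolding is_connection_def by blast

lemma connection_add_right:
  assumes "is_connection M C" "open U" "smooth_field_on M U X"
    "smooth_field_on M U Z" "smooth_field_on M U Z'" "p \<in> U"
  shows "C X (\<lambda>q. Z q + Z' q) p = C X Z p + C X Z' p"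
  using assms smooth_fun_const[of U 0] unfolding is_connection_def by blast

lemma connection_scale_right:
  assumes "is_connection M C" "open U" "smooth_field_on M U X"
    "smooth_field_on M U Z" "smooth_fun_on M U f" "p \<in> U"
  shows "C X (\<lambda>q. f q *\<^sub>R Z q) p = f p *\<^sub>R C X Z p + field_app M X f p *\<^sub>R Z p"
  using assms unfolding is_connection_def by blast

lemma connection_zero_left:
  assumes "is_connection M C" "open U" "smooth_field_on M U Z" "p \<in> U"
  shows "C (\<lambda>q. 0) Z p = 0"
  using connection_left[OF assms(1,2) smooth_field_zero smooth_field_zero assms(3) smooth_fun_const[of U 1] assms(4)]
    assms(2) by simp

lemma connection_diff_left:
  assumes "is_connection M C" "open U" "smooth_field_on M U X" "smooth_field_on M U X'"
    "smooth_field_on M U Z" "p \<in> U"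
  shows "C (\<lambda>q. X q - X' q) Z p = C X Z p - C X' Z p"
  using connection_left[OF assms(1,2,4,3,5) smooth_fun_const[of U "-1"] assms(6)] by simp

lemma connection_sum_left:
  assumes C: "is_connection M C" and U: "open U" "p \<in> U" and Z: "smooth_field_on M U Z"
    and X: "\<And>i. i \<in> I \<Longrightarrow> smooth_field_on M U (X i)" and f: "\<And>i. i \<in> I \<Longrightarrow> smooth_fun_on M U (f i)"
  shows "C (\<lambda>q. \<Sum>i\<in>I. f i q *\<^sub>R X i q) Z p = (\<Sum>i\<in>I. f i p *\<^sub>R C (X i) Z p)"
  using X f
proof (induction I rule: infinite_finite_induct)
  case (insert i I)
  have "smooth_field_on M U (\<lambda>q. \<Sum>i\<in>I. f i q *\<^sub>R X i q)"
    using insert by (intro smooth_field_sum smooth_field_scale U) auto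
  then have "C (\<lambda>q. f i q *\<^sub>R X i q + (\<Sum>i\<in>I. f i q *\<^sub>R X i q)) Z p =
      f i p *\<^sub>R C (X i) Z p + C (\<lambda>q. \<Sum>i\<in>I. f i q *\<^sub>R X i q) Z p"
    using insert by (intro connection_left[OF C U(1)] Z U) auto
  then show ?case using insert by simp
qed (simp_all add: connection_zero_left[OF C U(1) Z U(2)])

text \<open>The value of \<open>\<nabla>\<^sub>X Z\<close> at \<open>p\<close> depends on \<open>X\<close> only through its value at \<open>p\<close>.\<close>

lemma connection_frame_left:
  assumes C: "is_connection M C" and F: "adapted_frame M U F" "p \<in> U"
    and X: "smooth_field_on M U X" and Z: "smooth_field_on M U Z"
  shows "C X Z p = (\<Sum>b\<in>Basis. gmetric M p (X p) (F b p) *\<^sub>R C (F b) Z p)"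
proof -
  note U = adapted_frameD(1)[OF F(1)] and Fs = adapted_frameD(2)[OF F(1)]
  have "C X Z p = C (\<lambda>q. \<Sum>b\<in>Basis. gmetric M q (X q) (F b q) *\<^sub>R F b q) Z p"
    using connection_cong[OF C U X Z, of "\<lambda>q. \<Sum>b\<in>Basis. gmetric M q (X q) (F b q) *\<^sub>R F b q" Z p]
      orthonormal_expand[OF adapted_frameD(3)[OF F(1)]] F(2) by simp
  also have "\<dots> = (\<Sum>b\<in>Basis. gmetric M p (X p) (F b p) *\<^sub>R C (F b) Z p)"
    by (rule connection_sum_left[OF C U F(2) Z Fs smooth_metric[OF U X Fs]])
  finally show ?thesis .
qed

lemma connection_sum_right:
  assumes C: "is_connection M C" and U: "open U" "p \<in> U" and X: "smooth_field_on M U X"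
    and Z: "\<And>i. i \<in> I \<Longrightarrow> smooth_field_on M U (Z i)" and f: "\<And>i. i \<in> I \<Longrightarrow> smooth_fun_on M U (f i)"
  shows "C X (\<lambda>q. \<Sum>i\<in>I. f i q *\<^sub>R Z i q) p =
    (\<Sum>i\<in>I. f i p *\<^sub>R C X (Z i) p + field_app M X (f i) p *\<^sub>R Z i p)"
proof -
  have zero: "C X (\<lambda>q. 0) p = 0"
    using connection_add_right[OF C U(1) X smooth_field_zero[OF U(1)] smooth_field_zero[OF U(1)] U(2)] by simp
  show ?thesis
    using Z f
  proof (induction I rule: infinite_finite_induct)
    case (insert i I)
    have "smooth_field_on M U (\<lambda>q. f i q *\<^sub>R Z i q)" "smooth_field_on M U (\<lambda>q. \<Sum>i\<in>I. f i q *\<^sub>R Z i q)"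
      using insert by (auto intro!: smooth_field_sum smooth_field_scale U)
    then have "C X (\<lambda>q. f i q *\<^sub>R Z i q + (\<Sum>i\<in>I. f i q *\<^sub>R Z i q)) p =
        C X (\<lambda>q. f i q *\<^sub>R Z i q) p + C X (\<lambda>q. \<Sum>i\<in>I. f i q *\<^sub>R Z i q) p"
      by (intro connection_add_right[OF C U(1) X] U)
    then show ?case using insert connection_scale_right[OF C U(1) X, of "Z i" "f i"] U(2) by simp
  qed (simp_all add: zero)
qed

end

locale hladky_foliation = foliated_manifold M n m
  for M :: "('a::{t2_space, second_countable_topology}, 'e::euclidean_space) foliated" and n m +
  fixes D nab :: "('a, 'e) connection"
  assumes levi_civita: "levi_civita M D" and hladky: "hladky_connection M D nab"
begin

lemma D_connection: "is_connection M D"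
  using levi_civita unfolding levi_civita_def is_metric_connection_def by blast

lemma hladky_metric: "is_metric_connection M nab"
  and hladky_parallel: "\<And>S X A. open S \<and> smooth_field_on M S X \<and> smooth_field_on M S A \<Longrightarrow>
    vertical_on M S A \<Longrightarrow> vertical_on M S (nab X A)"
  and hladky_vertical: "\<And>S A B. open S \<and> smooth_field_on M S A \<and> smooth_field_on M S B \<Longrightarrow>
    vertical_on M S A \<and> vertical_on M S B \<Longrightarrow> \<forall>p\<in>S. nab A B p = vproj M p (D A B p)"
  using hladky unfolding hladky_connection_def by simp_all

lemma nab_connection: "is_connection M nab"
  using hladky_metric unfolding is_metric_connection_def by blast

lemmas nab_smooth = connection_smooth[OF nab_connection]

lemma nab_metric:
  assumes "open U" "smooth_field_on M U X" "smooth_field_on M U A" "smooth_field_on M U B" "p \<in> U"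
  shows "dir_deriv M (\<lambda>q. gmetric M q (A q) (B q)) p (X p) =
    gmetric M p (nab X A p) (B p) + gmetric M p (A p) (nab X B p)"
  using assms hladky_metric unfolding is_metric_connection_def field_app_def by blast

text \<open>Torsion-freeness of the Levi-Civita connection transfers the axioms of a connection to the bracket:
  its smoothness and its Leibniz rule then need no computation in charts.\<close>

lemma lie_bracket_levi_civita:
  assumes "open U" "smooth_field_on M U X" "smooth_field_on M U Z" "p \<in> U"
  shows "lie_bracket M X Z p = D X Z p - D Z X p"
proof -
  have "torsion M D X Z p = 0" using assms levi_civita unfolding levi_civita_def by blast
  then show ?thesis unfolding torsion_def by simp
qed

lemma smooth_lie_bracket:
  assumes "open U" "smooth_field_on M U X" "smooth_field_on M U Z"
  shows "smooth_field_on M U (lie_bracket M X Z)"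
  by (rule smooth_field_cong[OF assms(1) _
      smooth_field_diff[OF assms(1) connection_smooth[OF D_connection assms] connection_smooth[OF D_connection assms(1,3,2)]]])
    (simp add: lie_bracket_levi_civita[OF assms])

lemma nab_vertical:
  assumes "open U" "smooth_field_on M U X" "smooth_field_on M U A" "vertical_on M U A"
  shows "vertical_on M U (nab X A)"
  using hladky_parallel assms by blast

lemma nab_vertical_at:
  assumes "open U" "smooth_field_on M U X" "smooth_field_on M U A" "vertical_on M U A" "p \<in> U"
  shows "nab X A p \<in> vertical M p"
  using nab_vertical[OF assms(1-4)] assms(5) unfolding vertical_on_def by blast

text \<open>Along the leaves the connection is the projected Levi-Civita connection; since vertical fields
  are closed under brackets, no torsion arises.\<close>

lemma nab_vertical_torsion_free:
  assumes U: "open U" "p \<in> U" and A: "smooth_field_on M U A" "vertical_on M U A"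
    and B: "smooth_field_on M U B" "vertical_on M U B"
  shows "nab A B p - nab B A p = lie_bracket M A B p"
proof -
  have "nab A B p = vproj M p (D A B p)" "nab B A p = vproj M p (D B A p)"
    using hladky_vertical[of U A B] hladky_vertical[of U B A] assms by blast+
  then have "nab A B p - nab B A p = vproj M p (lie_bracket M A B p)"
    by (simp add: vproj_diff lie_bracket_levi_civita[OF U(1) A(1) B(1) U(2)])
  then show ?thesis using vproj_of_vertical[OF lie_bracket_vertical[OF U A B]] by simp
qed

text \<open>Differentiating the constant inner products of the frame fields.\<close>

lemma nab_orthonormal_antisym:
  assumes F: "adapted_frame M U F" "p \<in> U" and X: "smooth_field_on M U X"
    and a: "a \<in> leafdirs M" and b: "b \<in> leafdirs M"
  shows "gmetric M p (nab X (F a) p) (F b p) = - gmetric M p (nab X (F b) p) (F a p)"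
proof -
  note U = adapted_frameD(1)[OF F(1)]
  have "dir_deriv M (\<lambda>q. gmetric M q (F a q) (F b q)) p (X p) = dir_deriv M (\<lambda>q. if a = b then 1 else 0) p (X p)"
  proof (rule dir_deriv_cong[OF U F(2)])
    fix q assume "q \<in> U"
    moreover have "a \<in> Basis" "b \<in> Basis" using a b leafdirs_Basis(1) by auto
    ultimately show "gmetric M q (F a q) (F b q) = (if a = b then 1 else 0)"
      using adapted_frameD(3)[OF F(1)] unfolding orthonormal_at_def by blast
  qed
  then show ?thesis
    using nab_metric[OF U X smooth_leaf_frame[OF F(1) a] smooth_leaf_frame[OF F(1) b] F(2)]
      metric_sym[of p "F a p" "nab X (F b) p"] by (simp add: dir_deriv_const)
qed

section \<open>The vertical Hessian and Laplacian\<close>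

context
  fixes U F f
  assumes F: "adapted_frame M U F" and f: "smooth_fun_on M U f"
begin

lemmas frame_open = adapted_frameD(1)[OF F]
lemmas vgrad_smooth = smooth_vgrad[OF F f]
lemmas leaf_frame_smooth = smooth_leaf_frame[OF F]
lemmas leaf_frame_vertical = adapted_frameD(4)[OF F]

lemma nab_vgrad_vertical: "smooth_field_on M U X \<Longrightarrow> p \<in> U \<Longrightarrow> nab X (vgrad M f) p \<in> vertical M p"
  using nab_vertical_at[OF frame_open _ vgrad_smooth vertical_on_vgrad] .

text \<open>Since \<open>B\<close> is vertical, \<open>B f\<close> is the inner product of \<open>B\<close> with the vertical gradient, to which metric
  compatibility applies.\<close>

lemma second_derivative_hessian:
  assumes p: "p \<in> U" and A: "smooth_field_on M U A" and B: "smooth_field_on M U B" "vertical_on M U B"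
  shows "field_app M A (field_app M B f) p =
    gmetric M p (nab A (vgrad M f) p) (B p) + gmetric M p (vgrad M f p) (nab A B p)"
proof -
  have "field_app M A (field_app M B f) p = dir_deriv M (\<lambda>q. gmetric M q (vgrad M f q) (B q)) p (A p)"
    unfolding field_app_def
    using B(2) metric_vgrad[OF f] by (intro dir_deriv_cong[OF frame_open p]) (auto simp: vertical_on_def)
  then show ?thesis using nab_metric[OF frame_open A vgrad_smooth B(1) p] by simp
qed

text \<open>The vertical Hessian is symmetric because the connection has no torsion along the leaves.\<close>

lemma hessian_symmetric:
  assumes p: "p \<in> U" and A: "smooth_field_on M U A" "vertical_on M U A"
    and B: "smooth_field_on M U B" "vertical_on M U B"
  shows "gmetric M p (nab A (vgrad M f) p) (B p) = gmetric M p (nab B (vgrad M f) p) (A p)"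
proof -
  have "dir_deriv M f p (lie_bracket M A B p) =
      gmetric M p (vgrad M f p) (nab A B p - nab B A p)"
    using metric_vgrad[OF f p lie_bracket_vertical[OF frame_open p A B]]
    by (simp add: nab_vertical_torsion_free[OF frame_open p A B])
  then show ?thesis
    using lie_bracket_commutator[OF frame_open p A(1) B(1) f]
      second_derivative_hessian[OF p A(1) B] second_derivative_hessian[OF p B(1) A]
    by (simp add: metric_simps)
qed

lemma nab_vgrad_frame:
  assumes p: "p \<in> U" and A: "smooth_field_on M U A" "vertical_on M U A"
  shows "nab A (vgrad M f) p = (\<Sum>a\<in>leafdirs M. gmetric M p (A p) (F a p) *\<^sub>R nab (F a) (vgrad M f) p)"
proof -
  have "nab A (vgrad M f) p = (\<Sum>a\<in>Basis. gmetric M p (A p) (F a p) *\<^sub>R nab (F a) (vgrad M f) p)"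
    by (rule connection_frame_left[OF nab_connection F p A(1) vgrad_smooth])
  also have "\<dots> = (\<Sum>a\<in>leafdirs M. gmetric M p (A p) (F a p) *\<^sub>R nab (F a) (vgrad M f) p)"
    using leafdirs_Basis(1) A(2) p horizontal_vertical(2)[OF adapted_frameD(6)[OF F p]]
    by (intro sum.mono_neutral_right) (auto simp: vertical_on_def)
  finally show ?thesis .
qed

text \<open>The structure constants in the frame expression of the vertical Laplacian are exactly the
  correction by \<open>\<nabla>\<^sub>Z Z\<close> that turns second derivatives into the trace of the Hessian.\<close>

lemma frame_laplacian_trace:
  assumes p: "p \<in> U"
  shows "frame_laplacian M F f p = (\<Sum>a\<in>leafdirs M. gmetric M p (nab (F a) (vgrad M f) p) (F a p))"
proof -
  have corr: "gmetric M p (vgrad M f p) (nab (F a) (F a) p) =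
      (\<Sum>b\<in>leafdirs M. struct_const M F b a a p * field_app M (F b) f p)" if a: "a \<in> leafdirs M" for a
  proof -
    have "gmetric M p (nab (F a) (F a) p) (F b p) = struct_const M F b a a p" if b: "b \<in> leafdirs M" for b
    proof -
      have "gmetric M p (nab (F a) (F a) p) (F b p) = - gmetric M p (nab (F a) (F b) p) (F a p)"
        by (rule nab_orthonormal_antisym[OF F p leaf_frame_smooth[OF a] a b])
      moreover have "gmetric M p (nab (F b) (F a) p) (F a p) = 0"
        using nab_orthonormal_antisym[OF F p leaf_frame_smooth[OF b] a a] by simp
      moreover have "lie_bracket M (F b) (F a) p = nab (F b) (F a) p - nab (F a) (F b) p"
        by (rule nab_vertical_torsion_free[OF frame_open p leaf_frame_smooth[OF b] leaf_frame_vertical[OF b] leaf_frame_smooth[OF a] leaf_frame_vertical[OF a], symmetric])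
      ultimately show ?thesis unfolding struct_const_def by (simp add: metric_simps)
    qed
    then show ?thesis
      using vertical_parseval[OF F p vgrad_vertical, of f "nab (F a) (F a) p"]
        metric_vgrad[OF f p adapted_frameD(5)[OF F p]]
      by (simp add: field_app_def mult.commute)
  qed
  have "(\<Sum>a\<in>leafdirs M. field_app M (F a) (field_app M (F a) f) p) =
      (\<Sum>a\<in>leafdirs M. gmetric M p (nab (F a) (vgrad M f) p) (F a p)) +
      (\<Sum>a\<in>leafdirs M. \<Sum>b\<in>leafdirs M. struct_const M F b a a p * field_app M (F b) f p)"
    unfolding sum.distrib[symmetric]
    by (intro sum.cong refl) (simp add: second_derivative_hessian[OF p leaf_frame_smooth leaf_frame_smooth leaf_frame_vertical] corr)
  also have "(\<Sum>a\<in>leafdirs M. \<Sum>b\<in>leafdirs M. struct_const M F b a a p * field_app M (F b) f p) =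
     (\<Sum>a\<in>leafdirs M. \<Sum>b\<in>leafdirs M. struct_const M F a b b p * field_app M (F a) f p)"
    by (rule sum.swap)
  finally show ?thesis unfolding frame_laplacian_def by simp
qed

end

text \<open>Being a trace, the vertical Laplacian may be computed in any adapted frame.\<close>

lemma vlaplacian_trace:
  assumes F: "adapted_frame M U F" and f: "smooth_fun_on M U f" and p: "p \<in> U"
  shows "vlaplacian M f p = (\<Sum>a\<in>leafdirs M. gmetric M p (nab (F a) (vgrad M f) p) (F a p))"
proof -
  \<comment> \<open>the frame chosen at \<open>p\<close> by \<open>vlaplacian\<close>, possibly different for every \<open>p\<close>\<close>
  define G where "G = (SOME F. \<exists>U. p \<in> U \<and> adapted_frame M U F)"
  have "\<exists>F U. p \<in> U \<and> adapted_frame M U F" using F p by blast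
  from someI_ex[OF this] obtain W where W: "p \<in> W" "adapted_frame M W G" unfolding G_def by blast
  let ?S = "U \<inter> W"
  have S: "open ?S" "p \<in> ?S" using adapted_frameD(1) F W p by blast+
  have F': "adapted_frame M ?S F" and G': "adapted_frame M ?S G" and f': "smooth_fun_on M ?S f"
    using adapted_frame_subset[OF _ S(1)] F W smooth_fun_subset[OF f] by auto
  let ?N = "\<lambda>b. nab (F b) (vgrad M f) p"
  have "vlaplacian M f p = (\<Sum>a\<in>leafdirs M. gmetric M p (nab (G a) (vgrad M f) p) (G a p))"
    unfolding vlaplacian_def G_def[symmetric] by (rule frame_laplacian_trace[OF G' f' S(2)])
  also have "\<dots> = (\<Sum>a\<in>leafdirs M. \<Sum>b\<in>leafdirs M.
      gmetric M p (F b p) (G a p) * gmetric M p (?N b) (G a p))"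
    by (intro sum.cong refl)
      (simp add: nab_vgrad_frame[OF F' f' S(2) smooth_leaf_frame[OF G'] adapted_frameD(4)[OF G']] metric_simps
        metric_sym[of p "G _ p" "F _ p"])
  also have "\<dots> = (\<Sum>b\<in>leafdirs M. \<Sum>a\<in>leafdirs M.
      gmetric M p (F b p) (G a p) * gmetric M p (?N b) (G a p))"
    by (rule sum.swap)
  also have "\<dots> = (\<Sum>b\<in>leafdirs M. gmetric M p (?N b) (F b p))"
    by (intro sum.cong refl trans[OF vertical_parseval[OF G' S(2) adapted_frameD(5)[OF F' S(2)]] metric_sym])
  finally show ?thesis .
qed

section \<open>Curvature\<close>

lemma lie_bracket_frame_left:
  assumes F: "adapted_frame M U F" and q: "q \<in> U"
    and X: "smooth_field_on M U X" and Z: "smooth_field_on M U Z"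
  shows "lie_bracket M X Z q = (\<Sum>b\<in>Basis. gmetric M q (X q) (F b q) *\<^sub>R lie_bracket M (F b) Z q) -
    (\<Sum>b\<in>Basis. field_app M Z (\<lambda>q. gmetric M q (X q) (F b q)) q *\<^sub>R F b q)"
proof -
  note U = adapted_frameD(1)[OF F] and Fs = adapted_frameD(2)[OF F]
  let ?c = "\<lambda>b q. gmetric M q (X q) (F b q)"
  have c: "smooth_fun_on M U (?c b)" if "b \<in> Basis" for b by (rule smooth_metric[OF U X Fs[OF that]])
  have "D Z X q = D Z (\<lambda>q. \<Sum>b\<in>Basis. ?c b q *\<^sub>R F b q) q"
    using connection_cong[OF D_connection U Z X, of Z "\<lambda>q. \<Sum>b\<in>Basis. ?c b q *\<^sub>R F b q" q]
      orthonormal_expand[OF adapted_frameD(3)[OF F]] q by simp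
  also have "\<dots> = (\<Sum>b\<in>Basis. ?c b q *\<^sub>R D Z (F b) q + field_app M Z (?c b) q *\<^sub>R F b q)"
    by (rule connection_sum_right[OF D_connection U q Z Fs c])
  finally show ?thesis
    using connection_frame_left[OF D_connection F q X Z]
    by (simp add: lie_bracket_levi_civita[OF U _ Z q] X Fs sum.distrib sum_subtractf scaleR_diff_right)
qed

text \<open>The curvature is tensorial in its first argument: the derivatives of the coefficients in the
  second covariant derivative cancel against those in the bracket.\<close>

lemma curvature_frame_left:
  assumes F: "adapted_frame M U F" and p: "p \<in> U"
    and X: "smooth_field_on M U X" and Z: "smooth_field_on M U Z" and A: "smooth_field_on M U A"
  shows "curvature M nab X Z A p = (\<Sum>b\<in>Basis. gmetric M p (X p) (F b p) *\<^sub>R curvature M nab (F b) Z A p)"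
proof -
  note U = adapted_frameD(1)[OF F] and Fs = adapted_frameD(2)[OF F]
  note sm = nab_smooth[OF U]
  let ?c = "\<lambda>b q. gmetric M q (X q) (F b q)"
  let ?d = "\<lambda>b. field_app M Z (?c b)"
  have c: "smooth_fun_on M U (?c b)" if "b \<in> Basis" for b by (rule smooth_metric[OF U X Fs[OF that]])
  have d: "smooth_fun_on M U (?d b)" if "b \<in> Basis" for b by (rule smooth_field_app[OF U Z c[OF that]])
  have br: "smooth_field_on M U (lie_bracket M (F b) Z)" if "b \<in> Basis" for b
    by (rule smooth_lie_bracket[OF U Fs[OF that] Z])
  have 1: "nab X (nab Z A) p = (\<Sum>b\<in>Basis. ?c b p *\<^sub>R nab (F b) (nab Z A) p)"
    by (rule connection_frame_left[OF nab_connection F p X sm[OF Z A]])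
  have "nab Z (nab X A) p = nab Z (\<lambda>q. \<Sum>b\<in>Basis. ?c b q *\<^sub>R nab (F b) A q) p"
    using connection_cong[OF nab_connection U Z sm[OF X A], of Z "\<lambda>q. \<Sum>b\<in>Basis. ?c b q *\<^sub>R nab (F b) A q" p]
      connection_frame_left[OF nab_connection F _ X A] p by simp
  also have "\<dots> = (\<Sum>b\<in>Basis. ?c b p *\<^sub>R nab Z (nab (F b) A) p + ?d b p *\<^sub>R nab (F b) A p)"
    by (rule connection_sum_right[OF nab_connection U p Z sm[OF Fs A] c])
  finally have 2: "nab Z (nab X A) p = \<dots>" .
  have B: "smooth_field_on M U (\<lambda>q. \<Sum>b\<in>Basis. ?c b q *\<^sub>R lie_bracket M (F b) Z q)"
      "smooth_field_on M U (\<lambda>q. \<Sum>b\<in>Basis. ?d b q *\<^sub>R F b q)"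
    by (intro smooth_field_sum smooth_field_scale U c d br Fs; assumption)+
  have "nab (lie_bracket M X Z) A p = nab (\<lambda>q. (\<Sum>b\<in>Basis. ?c b q *\<^sub>R lie_bracket M (F b) Z q) -
      (\<Sum>b\<in>Basis. ?d b q *\<^sub>R F b q)) A p"
    by (rule connection_cong[OF nab_connection U smooth_lie_bracket[OF U X Z] A lie_bracket_frame_left[OF F _ X Z] refl p])
  also have "\<dots> = (\<Sum>b\<in>Basis. ?c b p *\<^sub>R nab (lie_bracket M (F b) Z) A p) - (\<Sum>b\<in>Basis. ?d b p *\<^sub>R nab (F b) A p)"
    unfolding connection_diff_left[OF nab_connection U B A p]
    by (rule arg_cong2[where f = minus, OF connection_sum_left[OF nab_connection U p A br c]
      connection_sum_left[OF nab_connection U p A Fs d]])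
  finally show ?thesis
    unfolding curvature_def 1 2
    by (simp add: sum.distrib sum_subtractf scaleR_diff_right)
qed

text \<open>For a vertical field \<open>A\<close> the Ricci trace is a trace along the leaf, since \<open>R(W, A)A\<close> is then
  vertical.  The trace in the coordinate basis becomes one in the orthonormal frame.\<close>

lemma ricci_vertical_trace:
  assumes F: "adapted_frame M U F" and p: "p \<in> U" and U': "U \<subseteq> cdom (chart_at M p)"
    and A: "smooth_field_on M U A" "vertical_on M U A"
  shows "ricci M nab A A p = (\<Sum>a\<in>leafdirs M. gmetric M p (curvature M nab (F a) A A p) (F a p))"
proof -
  note U = adapted_frameD(1)[OF F] and Fs = adapted_frameD(2)[OF F]
  let ?C = "\<lambda>b. curvature M nab (F b) A A p"
  have const: "smooth_field_on M U (const_field M p v)" for v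
    by (rule smooth_field_subset[OF smooth_const_field U'])
  have "ricci M nab A A p = (\<Sum>e\<in>Basis. \<Sum>b\<in>Basis. gmetric M p e (F b p) * (?C b \<bullet> e))"
    unfolding ricci_def curvature_frame_left[OF F p const A(1) A(1)] const_field_at
    by (simp add: inner_sum_left)
  also have "\<dots> = (\<Sum>b\<in>Basis. \<Sum>e\<in>Basis. gmetric M p e (F b p) * (?C b \<bullet> e))" by (rule sum.swap)
  also have "\<dots> = (\<Sum>b\<in>Basis. gmetric M p (\<Sum>e\<in>Basis. (?C b \<bullet> e) *\<^sub>R e) (F b p))"
    by (simp only: metric_simps real_scaleR_def mult.commute)
  also have "\<dots> = (\<Sum>b\<in>Basis. gmetric M p (?C b) (F b p))" by (simp only: euclidean_representation)
  also have "\<dots> = (\<Sum>a\<in>leafdirs M. gmetric M p (?C a) (F a p))"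
  proof (rule sum.mono_neutral_right)
    show "\<forall>b\<in>Basis - leafdirs M. gmetric M p (?C b) (F b p) = 0"
    proof
      fix b assume b: "b \<in> Basis - leafdirs M"
      then have Fb: "smooth_field_on M U (F b)" using Fs by blast
      have "?C b \<in> vertical M p" unfolding curvature_def
        by (intro subspace_diff[OF subspace_vertical] nab_vertical_at[OF U] nab_vertical[OF U]
            nab_smooth[OF U] smooth_lie_bracket[OF U] Fb A p)
      then show "gmetric M p (?C b) (F b p) = 0"
        using horizontal_vertical(2)[OF adapted_frameD(6)[OF F p b]] by blast
    qed
  qed (use leafdirs_Basis in auto)
  finally show ?thesis .
qed

section \<open>The Bochner identity along the leaves\<close>

context
  fixes U F f
  assumes F: "adapted_frame M U F" and f: "smooth_fun_on M U f"
begin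

text \<open>Pairing with a vertical field \<open>Z\<close>, the derivative of \<open>\<bar>V\<bar>\<^sup>2\<close> along \<open>Z\<close> is \<open>2 \<langle>\<nabla>\<^sub>Z V, V\<rangle>\<close>, which is
  \<open>2 \<langle>\<nabla>\<^sub>V V, Z\<rangle>\<close> by symmetry of the Hessian.\<close>

lemma vgrad_energy:
  assumes q: "q \<in> U"
  shows "vgrad M (\<lambda>q. gmetric M q (vgrad M f q) (vgrad M f q)) q =
    nab (vgrad M f) (vgrad M f) q + nab (vgrad M f) (vgrad M f) q"
proof (rule vertical_frame_eqI[OF F q])
  note V = smooth_vgrad[OF F f] and U = adapted_frameD(1)[OF F]
  have "nab (vgrad M f) (vgrad M f) q \<in> vertical M q"
    by (rule nab_vgrad_vertical[OF F f V q])
  then show "nab (vgrad M f) (vgrad M f) q + nab (vgrad M f) (vgrad M f) q \<in> vertical M q"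
    using subspace_add[OF subspace_vertical] by blast
  fix a assume a: "a \<in> leafdirs M"
  show "gmetric M q (vgrad M (\<lambda>q. gmetric M q (vgrad M f q) (vgrad M f q)) q) (F a q) =
      gmetric M q (nab (vgrad M f) (vgrad M f) q + nab (vgrad M f) (vgrad M f) q) (F a q)"
    unfolding metric_vgrad[OF smooth_metric[OF U V V] q adapted_frameD(5)[OF F q a]]
      nab_metric[OF U smooth_leaf_frame[OF F a] V V q]
    using hessian_symmetric[OF F f q smooth_leaf_frame[OF F a] adapted_frameD(4)[OF F a] V vertical_on_vgrad]
    by (simp add: metric_simps metric_sym[of q "vgrad M f q"])
qed (rule vgrad_vertical)

text \<open>Contracting the symmetric Hessian with the antisymmetric matrix of \<open>\<nabla>\<^sub>V\<close> in an orthonormal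
  frame gives zero.\<close>

lemma hessian_frame_rotation:
  assumes p: "p \<in> U"
  shows "(\<Sum>a\<in>leafdirs M. gmetric M p (nab (F a) (vgrad M f) p) (nab (vgrad M f) (F a) p)) = 0"
proof -
  note V = smooth_vgrad[OF F f] and Fs = smooth_leaf_frame[OF F]
  let ?h = "\<lambda>a b. gmetric M p (nab (F a) (vgrad M f) p) (F b p)"
  let ?c = "\<lambda>a b. gmetric M p (nab (vgrad M f) (F a) p) (F b p)"
  have "(\<Sum>a\<in>leafdirs M. gmetric M p (nab (F a) (vgrad M f) p) (nab (vgrad M f) (F a) p)) =
      (\<Sum>a\<in>leafdirs M. \<Sum>b\<in>leafdirs M. ?h a b * ?c a b)"
    by (intro sum.cong refl) (simp add: vertical_parseval[OF F p nab_vgrad_vertical[OF F f Fs p]])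
  moreover have "(\<Sum>a\<in>leafdirs M. \<Sum>b\<in>leafdirs M. ?h a b * ?c a b) =
      - (\<Sum>a\<in>leafdirs M. \<Sum>b\<in>leafdirs M. ?h a b * ?c a b)" (is "?S = - ?S")
  proof -
    have "?S = (\<Sum>b\<in>leafdirs M. \<Sum>a\<in>leafdirs M. ?h a b * ?c a b)" by (rule sum.swap)
    also have "\<dots> = (\<Sum>b\<in>leafdirs M. \<Sum>a\<in>leafdirs M. - (?h b a * ?c b a))"
    proof (intro sum.cong refl)
      fix a b assume a: "a \<in> leafdirs M" and b: "b \<in> leafdirs M"
      show "?h a b * ?c a b = - (?h b a * ?c b a)"
        using hessian_symmetric[OF F f p Fs[OF a] adapted_frameD(4)[OF F a] Fs[OF b] adapted_frameD(4)[OF F b]]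
          nab_orthonormal_antisym[OF F p V a b] by simp
    qed
    also have "\<dots> = - ?S" by (simp only: sum_negf)
    finally show ?thesis .
  qed
  ultimately show ?thesis by linarith
qed

lemma smooth_hessian_trace:
  "smooth_fun_on M U (\<lambda>q. \<Sum>a\<in>leafdirs M. gmetric M q (nab (F a) (vgrad M f) q) (F a q))"
  using adapted_frameD(1)[OF F] smooth_vgrad[OF F f] smooth_leaf_frame[OF F]
  by (intro smooth_fun_sum smooth_metric nab_smooth)

lemma smooth_vlaplacian: "smooth_fun_on M U (vlaplacian M f)"
  by (rule smooth_fun_cong[OF adapted_frameD(1)[OF F] _ smooth_hessian_trace])
    (simp add: vlaplacian_trace[OF F f])

text \<open>With \<open>V\<close> the vertical gradient and \<open>Z\<^sub>a\<close> the vertical frame, the left-hand side is the sum over \<open>a\<close> of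
  \<open>\<langle>\<nabla>\<^sub>Z \<nabla>\<^sub>V V, Z\<rangle> - \<langle>\<nabla>\<^sub>V \<nabla>\<^sub>Z V, Z\<rangle> - \<langle>\<nabla>\<^sub>Z V, \<nabla>\<^sub>V Z\<rangle>\<close> with \<open>Z = Z\<^sub>a\<close>.  Commuting the derivatives gives the
  curvature and \<open>\<langle>\<nabla>\<^bsub>[Z, V]\<^esub> V, Z\<rangle>\<close>, which by symmetry of the Hessian is
  \<open>\<langle>\<nabla>\<^sub>Z V, \<nabla>\<^sub>Z V - \<nabla>\<^sub>V Z\<rangle>\<close>; the mixed terms sum to zero.\<close>

lemma bochner_leafwise:
  assumes p: "p \<in> U"
  shows "vlaplacian M (\<lambda>q. gmetric M q (vgrad M f q) (vgrad M f q)) p / 2 -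
      dir_deriv M (vlaplacian M f) p (vgrad M f p) =
    (\<Sum>a\<in>leafdirs M. gmetric M p (nab (F a) (vgrad M f) p) (nab (F a) (vgrad M f) p)) +
    (\<Sum>a\<in>leafdirs M. gmetric M p (curvature M nab (F a) (vgrad M f) (vgrad M f) p) (F a p))"
proof -
  let ?V = "vgrad M f"
  let ?h = "\<lambda>q. gmetric M q (?V q) (?V q)"
  note V = smooth_vgrad[OF F f] and Fs = smooth_leaf_frame[OF F] and U = adapted_frameD(1)[OF F]
  note Fv = adapted_frameD(4)[OF F]
  note VV = nab_smooth[OF U V V]
  have lap: "vlaplacian M ?h p = (\<Sum>a\<in>leafdirs M. 2 * gmetric M p (nab (F a) (nab ?V ?V) p) (F a p))"
    unfolding vlaplacian_trace[OF F smooth_metric[OF U V V] p]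
  proof (intro sum.cong refl)
    fix a assume a: "a \<in> leafdirs M"
    have "nab (F a) (vgrad M ?h) p = nab (F a) (\<lambda>q. nab ?V ?V q + nab ?V ?V q) p"
      by (rule connection_cong[OF nab_connection U Fs[OF a] smooth_vgrad[OF F smooth_metric[OF U V V]] refl vgrad_energy p])
    then show "gmetric M p (nab (F a) (vgrad M ?h) p) (F a p) = 2 * gmetric M p (nab (F a) (nab ?V ?V) p) (F a p)"
      using connection_add_right[OF nab_connection U Fs[OF a] VV VV p] by (simp add: metric_simps)
  qed
  have "dir_deriv M (vlaplacian M f) p (?V p) =
      dir_deriv M (\<lambda>q. \<Sum>a\<in>leafdirs M. gmetric M q (nab (F a) ?V q) (F a q)) p (?V p)"
    by (rule dir_deriv_cong[OF U p]) (rule vlaplacian_trace[OF F f])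
  also have "\<dots> = (\<Sum>a\<in>leafdirs M. dir_deriv M (\<lambda>q. gmetric M q (nab (F a) ?V q) (F a q)) p (?V p))"
    by (rule dir_deriv_sum[OF U smooth_metric[OF U nab_smooth[OF U Fs V] Fs] p])
  also have "\<dots> = (\<Sum>a\<in>leafdirs M. gmetric M p (nab ?V (nab (F a) ?V) p) (F a p) +
      gmetric M p (nab (F a) ?V p) (nab ?V (F a) p))"
    by (intro sum.cong refl) (rule nab_metric[OF U V nab_smooth[OF U Fs V] Fs p])
  finally have der: "dir_deriv M (vlaplacian M f) p (?V p) = \<dots>" .
  have pointwise: "gmetric M p (nab (F a) (nab ?V ?V) p) (F a p) -
      (gmetric M p (nab ?V (nab (F a) ?V) p) (F a p) + gmetric M p (nab (F a) ?V p) (nab ?V (F a) p)) =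
    gmetric M p (nab (F a) ?V p) (nab (F a) ?V p) + gmetric M p (curvature M nab (F a) ?V ?V p) (F a p) -
    2 * gmetric M p (nab (F a) ?V p) (nab ?V (F a) p)"
    if a: "a \<in> leafdirs M" for a
  proof -
    have W: "smooth_field_on M U (lie_bracket M (F a) ?V)" "vertical_on M U (lie_bracket M (F a) ?V)"
      using smooth_lie_bracket[OF U Fs[OF a] V]
        lie_bracket_vertical[OF U _ Fs[OF a] Fv[OF a] V vertical_on_vgrad]
      unfolding vertical_on_def by blast+
    have "gmetric M p (nab (lie_bracket M (F a) ?V) ?V p) (F a p) =
        gmetric M p (nab (F a) ?V p) (lie_bracket M (F a) ?V p)"
      by (rule hessian_symmetric[OF F f p W Fs[OF a] Fv[OF a]])
    moreover have "lie_bracket M (F a) ?V p = nab (F a) ?V p - nab ?V (F a) p"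
      by (rule nab_vertical_torsion_free[OF U p Fs[OF a] Fv[OF a] V vertical_on_vgrad, symmetric])
    ultimately show ?thesis unfolding curvature_def by (simp add: metric_simps)
  qed
  have "vlaplacian M ?h p / 2 - dir_deriv M (vlaplacian M f) p (?V p) =
      (\<Sum>a\<in>leafdirs M. gmetric M p (nab (F a) (nab ?V ?V) p) (F a p) -
      (gmetric M p (nab ?V (nab (F a) ?V) p) (F a p) + gmetric M p (nab (F a) ?V p) (nab ?V (F a) p)))"
    unfolding lap der sum_subtractf by (simp add: sum_divide_distrib sum_distrib_left[symmetric])
  also have "\<dots> = (\<Sum>a\<in>leafdirs M. gmetric M p (nab (F a) ?V p) (nab (F a) ?V p)) +
     (\<Sum>a\<in>leafdirs M. gmetric M p (curvature M nab (F a) ?V ?V p) (F a p)) -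
     2 * (\<Sum>a\<in>leafdirs M. gmetric M p (nab (F a) ?V p) (nab ?V (F a) p))"
    unfolding sum_distrib_left sum.distrib[symmetric] sum_subtractf[symmetric]
    by (intro sum.cong refl pointwise)
  finally show ?thesis using hessian_frame_rotation[OF p] by simp
qed

text \<open>The Hilbert-Schmidt norm is defined with an unspecified orthonormal basis, so Parseval's identity is
  used in both arguments: once in that basis to contract the second one, and once after expanding the
  frame vectors in it.\<close>

lemma vhessian_norm_frame:
  assumes p: "p \<in> U" and U': "U \<subseteq> cdom (chart_at M p)"
  shows "vhessian_norm_sq M nab f p =
    (\<Sum>a\<in>leafdirs M. gmetric M p (nab (F a) (vgrad M f) p) (nab (F a) (vgrad M f) p))"
proof -
  note V = smooth_vgrad[OF F f] and Fs = smooth_leaf_frame[OF F] and U = adapted_frameD(1)[OF F]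
  let ?N = "\<lambda>a. nab (F a) (vgrad M f) p"
  \<comment> \<open>the Hessian as an endomorphism\<close>
  define T where "T v = (\<Sum>a\<in>leafdirs M. gmetric M p v (F a p) *\<^sub>R ?N a)" for v
  have hess: "vhessian M nab f (const_field M p v) (const_field M p w) p = gmetric M p (T v) w" for v w
  proof -
    have const: "smooth_field_on M U (const_field M p v)"
      by (rule smooth_field_subset[OF smooth_const_field U'])
    let ?P = "\<lambda>q. vproj M q (const_field M p v q)"
    have P: "smooth_field_on M U ?P" "vertical_on M U ?P"
      by (rule smooth_field_cong[OF U vproj_frame(1)[OF F, symmetric]])
        (auto intro!: smooth_field_sum smooth_field_scale smooth_metric U Fs const simp: vertical_on_def vproj_vertical)
    have "nab ?P (vgrad M f) p = T v"
      unfolding nab_vgrad_frame[OF F f p P] T_def const_field_at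
      by (intro sum.cong refl) (simp add: metric_vproj adapted_frameD(5)[OF F p])
    moreover have "T v \<in> vertical M p"
      unfolding T_def by (intro subspace_sum subspace_scale subspace_vertical nab_vgrad_vertical[OF F f Fs p])
    ultimately show ?thesis
      unfolding vhessian_def const_field_at by (simp add: metric_vproj metric_sym[of p "T v"])
  qed
  define e where "e = (SOME e :: 'e \<Rightarrow> 'e. orthonormal_at p Basis e)"
  have e: "orthonormal_at p Basis e"
    unfolding e_def by (rule someI[of _ "\<lambda>b. F b p"]) (rule adapted_frameD(3)[OF F p])
  have on: "orthonormal_at p (leafdirs M) (\<lambda>a. F a p)"
    using adapted_frameD(3)[OF F p] leafdirs_Basis(1) unfolding orthonormal_at_def by blast
  have "vhessian_norm_sq M nab f p = (\<Sum>x\<in>Basis. \<Sum>y\<in>Basis. (gmetric M p (T (e x)) (e y))\<^sup>2)"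
    unfolding vhessian_norm_sq_def hs_norm_sq_def hess orthonormal_at_def[symmetric] e_def[symmetric] Let_def ..
  also have "\<dots> = (\<Sum>x\<in>Basis. gmetric M p (T (e x)) (T (e x)))"
    unfolding power2_eq_square parseval[OF e] ..
  also have "\<dots> = (\<Sum>x\<in>Basis. \<Sum>a\<in>leafdirs M. gmetric M p (F a p) (e x) * gmetric M p (T (e x)) (?N a))"
    unfolding T_def[of "e _"] bilinear_lmul metric_sum_right bilinear_rmul[OF bilinear_metric]
    by (simp add: metric_sym[of p "e _"])
  also have "\<dots> = (\<Sum>a\<in>leafdirs M. \<Sum>x\<in>Basis. gmetric M p (F a p) (e x) * gmetric M p (T (e x)) (?N a))"
    by (rule sum.swap)
  also have "\<dots> = (\<Sum>a\<in>leafdirs M. gmetric M p (T (\<Sum>x\<in>Basis. gmetric M p (F a p) (e x) *\<^sub>R e x)) (?N a))"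
  proof -
    have "linear T" unfolding T_def
      by (intro linear_compose_sum ballI linearI) (simp_all add: metric_simps scaleR_add_left)
    then show ?thesis by (simp add: linear_sum linear_scale metric_sum_left bilinear_lmul[OF bilinear_metric])
  qed
  also have "\<dots> = (\<Sum>a\<in>leafdirs M. gmetric M p (T (F a p)) (?N a))"
    unfolding orthonormal_expand[OF e] ..
  also have "\<dots> = (\<Sum>a\<in>leafdirs M. gmetric M p (?N a) (?N a))"
  proof (intro sum.cong refl)
    fix a assume a: "a \<in> leafdirs M"
    have "T (F a p) = (\<Sum>b\<in>leafdirs M. (if b = a then 1 else 0) *\<^sub>R ?N b)"
      unfolding T_def using on a unfolding orthonormal_at_def by (intro sum.cong refl) auto
    also have "\<dots> = ?N a" using a leafdirs_Basis(2)
      by (simp add: if_distrib[of "\<lambda>t. t *\<^sub>R _"] sum.delta cong: if_cong)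
    finally show "gmetric M p (T (F a p)) (?N a) = gmetric M p (?N a) (?N a)" by simp
  qed
  finally show ?thesis .
qed

text \<open>Let \<open>V\<close> be the vertical gradient, so that \<open>V f = \<bar>V\<bar>\<^sup>2\<close> and \<open>[Y, V] f = Y \<bar>V\<bar>\<^sup>2 - V (Y f)\<close>.  The bracket
  is expressed by the connection and its torsion, and \<open>\<nabla>\<^sub>Y V\<close> stays vertical, so that its inner products
  with \<open>\<nabla> f\<close> and with \<open>V\<close> agree.\<close>

lemma drift_term:
  assumes p: "p \<in> U" and Y: "smooth_field_on M U Y"
  shows "field_app M Y (\<lambda>q. gmetric M q (vgrad M f q) (vgrad M f q)) p / 2 -
      dir_deriv M (field_app M Y f) p (vgrad M f p) =
    - gmetric M p (nab (vgrad M f) Y p) (grad M f p) -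
      gmetric M p (torsion M nab Y (vgrad M f) p) (grad M f p)"
proof -
  let ?V = "vgrad M f"
  let ?h = "\<lambda>q. gmetric M q (?V q) (?V q)"
  note V = smooth_vgrad[OF F f] and U = adapted_frameD(1)[OF F]
  have "field_app M Y (field_app M ?V f) p = field_app M Y ?h p"
    unfolding field_app_def using metric_vgrad[OF f _ vgrad_vertical]
    by (intro dir_deriv_cong[OF U p]) simp
  then have "dir_deriv M f p (lie_bracket M Y ?V p) =
      field_app M Y ?h p - dir_deriv M (field_app M Y f) p (?V p)"
    using lie_bracket_commutator[OF U p Y V f] by (simp add: field_app_def[of M ?V "field_app M Y f"])
  moreover have "field_app M Y ?h p = 2 * gmetric M p (nab Y ?V p) (?V p)"
    unfolding field_app_def nab_metric[OF U Y V V p] by (simp add: metric_sym[of p "?V p"])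
  moreover have "gmetric M p (nab Y ?V p) (?V p) = gmetric M p (nab Y ?V p) (grad M f p)"
    using metric_vgrad[OF f p nab_vgrad_vertical[OF F f Y p]] metric_grad[OF f p, of "nab Y ?V p"]
    by (simp add: metric_sym[of p "nab Y ?V p"])
  moreover have "dir_deriv M f p (lie_bracket M Y ?V p) = gmetric M p (lie_bracket M Y ?V p) (grad M f p)"
    using metric_grad[OF f p] by (simp add: metric_sym[of p _ "grad M f p"])
  ultimately show ?thesis unfolding torsion_def by (simp add: metric_simps)
qed

end

end

section \<open>The iterated carre du champ of a Kolmogorov type operator\<close>

theorem proposition2p2:
  fixes M :: "('a::{t2_space, second_countable_topology}, 'e::euclidean_space) foliated"
    and n m :: nat
    and Y :: "'a \<Rightarrow> 'e"
    and D nab :: "('a, 'e) connection"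
    and f :: "'a \<Rightarrow> real"
  assumes "foliated_riemannian_manifold n m M"
    and "connected (UNIV :: 'a set)"
    and "smooth_field_on M UNIV Y"
    and "hypoelliptic M (kolmogorov_op M Y)"
    and "levi_civita M D"
    and "hladky_connection M D nab"
    and "f \<in> smooth_compactly_supported M"
  shows "\<forall>p. \<Gamma>\<^sub>2 M (kolmogorov_op M Y) f f p =
           vhessian_norm_sq M nab f p
           + ricci M nab (vgrad M f) (vgrad M f) p
           - cov_form M nab Y (vgrad M f) (grad M f) p
           - gmetric M p (torsion M nab Y (vgrad M f) p) (grad M f p)"
proof
  fix p
  interpret hladky_foliation M n m D nab
    using assms by unfold_locales
  let ?V = "vgrad M f" and ?U = "cdom (chart_at M p)"
  let ?h = "\<lambda>q. gmetric M q (?V q) (?V q)"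
  have p: "p \<in> ?U" by (rule in_chart_at)
  obtain F where F: "adapted_frame M ?U F" using adapted_frame_exists by blast
  note U = adapted_frameD(1)[OF F]
  have f: "smooth_fun_on M ?U f"
    using assms(7) smooth_fun_subset[of UNIV f ?U] unfolding smooth_compactly_supported_def by simp
  have Y: "smooth_field_on M ?U Y" using smooth_field_subset[OF assms(3)] by simp
  note Yf = smooth_field_app[OF U Y f] and lap = smooth_vlaplacian[OF F f]
  have L: "kolmogorov_op M Y u = (\<lambda>q. vlaplacian M u q + field_app M Y u q)" for u
    unfolding kolmogorov_op_def by (rule ext) simp
  have "\<Gamma> M f (kolmogorov_op M Y f) p = dir_deriv M (kolmogorov_op M Y f) p (?V p)"
    unfolding \<Gamma>_def L
    using metric_vgrad[OF smooth_fun_add[OF U lap Yf] p vgrad_vertical[of f p]]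
    by (simp add: metric_sym[of p "?V p"])
  also have "\<dots> = dir_deriv M (vlaplacian M f) p (?V p) + dir_deriv M (field_app M Y f) p (?V p)"
    unfolding L by (rule dir_deriv_add[OF lap Yf p])
  finally have "\<Gamma>\<^sub>2 M (kolmogorov_op M Y) f f p =
      (vlaplacian M ?h p / 2 - dir_deriv M (vlaplacian M f) p (?V p)) +
      (field_app M Y ?h p / 2 - dir_deriv M (field_app M Y f) p (?V p))"
    unfolding \<Gamma>\<^sub>2_def L[of "\<Gamma> M f f"] by (simp add: \<Gamma>_def[abs_def] field_simps)
  then show "\<Gamma>\<^sub>2 M (kolmogorov_op M Y) f f p =
           vhessian_norm_sq M nab f p
           + ricci M nab (vgrad M f) (vgrad M f) p
           - cov_form M nab Y (vgrad M f) (grad M f) p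
           - gmetric M p (torsion M nab Y (vgrad M f) p) (grad M f p)"
    unfolding bochner_leafwise[OF F f p] drift_term[OF F f p Y] cov_form_def
      vhessian_norm_frame[OF F f p order_refl]
      ricci_vertical_trace[OF F p order_refl smooth_vgrad[OF F f] vertical_on_vgrad]
    by simp
qed

end
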